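(* Let $\Lambda$ be a strongly connected finite $k$-graph with no sources, let $\Lambda^\infty$ be its infinite path space with Perron-Frobenius measure $M$, and fix $J=(j_1,\dots,j_k)\in(\mathbb{Z}^+)^k$ (all coordinates positive). For $v\in\Lambda^0$ let $D_v^J=\{\lambda\in\Lambda: d(\lambda)=J,\ r(\lambda)=v\}$ and $d_v^J=|D_v^J|$, and let $f^{m,v}\in L^2(\Lambda^\infty,M)$ ($v\in\Lambda^0$, $1\le m\le d_v^J-1$) be the functions $f^{m,v}=\sum_{\lambda\in D_v^J}c^{m,v}_\lambda\Theta_\lambda$ described in the context. For each integer $j\ge 1$ and $v\in\Lambda^0$ let $$C_{j,v}^J=\{\lambda\in\Lambda: s(\lambda)=v,\ d(\lambda)=jJ\},$$ and for $\lambda\in\Lambda$ let $S_\lambda$ be the operator on $L^2(\Lambda^\infty,M)$ given by $$S_\lambda\xi(x)=\Theta_\lambda(x)\,\rho(\Lambda)^{d(\lambda)/2}\,\xi(\sigma^{d(\lambda)}(x)),\qquad \xi\in L^2(\Lambda^\infty,M).$$ Then: (1) For each fixed $j\ge 1$, the family $\{S_\lambda f^{m,v}: v\in\Lambda^0,\ \lambda\in C_{j,v}^J,\ 1\le m\le d_v^J-1\}$ is an orthonormal set in $L^2(\Lambda^\infty,M)$. (2) If $0<i<j$, $v,v'\in\Lambda^0$, $\lambda\in C_{j,v}^J$ and $\mu\in C_{i,v'}^J$, then $$\int_{\Lambda^\infty}S_\lambda f^{m,v}\,\overline{S_\mu f^{m',v'}}\,dM=0\quad\text{for } 1\le m\le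 d_v^J-1,\ 1\le m'\le d_{v'}^J-1.$$ (3) Setting $\mathcal{V}_{0,\Lambda}=\overline{\mathrm{span}}\{\Theta_v: v\in\Lambda^0\}$, $\mathcal{W}^J_{0,\Lambda}=\overline{\mathrm{span}}\{f^{m,v}: v\in\Lambda^0,\ 1\le m\le d_v^J-1\}$ and, for $j\ge 1$, $$\mathcal{W}^J_{j,\Lambda}=\overline{\mathrm{span}}\{S_\lambda f^{m,v}: v\in\Lambda^0,\ \lambda\in C_{j,v}^J,\ 1\le m\le d_v^J-1\},$$ one obtains the orthogonal (Hilbert space) decomposition $$L^2(\Lambda^\infty,M)=\overline{\mathrm{span}}\,S^J=\mathcal{V}_{0,\Lambda}\oplus\bigoplus_{j=0}^\infty\mathcal{W}^J_{j,\Lambda},$$ where $S^J=\{\Theta_\lambda:\lambda\in\Lambda,\ d(\lambda)=nJ\text{ for some }n\in\mathbb{N}\}$.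
   Context: Conventions: $\mathbb{N}$ contains $0$; $e_1,\dots,e_k$ is the standard basis of $\mathbb{N}^k$. A $k$-graph (higher-rank graph) is a countable small category $\Lambda$ with a degree functor $d:\Lambda\to\mathbb{N}^k$ ($\mathbb{N}^k$ regarded as a one-object category with composition given by addition) satisfying the factorization property: if $d(\lambda)=m+n$ then there are unique $\alpha,\beta\in\Lambda$ with $d(\alpha)=m$, $d(\beta)=n$, $\lambda=\alpha\beta$. For $n\in\mathbb{N}^k$, $\Lambda^n=d^{-1}(n)$; $\Lambda^0$ is the set of vertices (identified with the objects), and $r,s:\Lambda\to\Lambda^0$ are the range and source maps, so $\alpha\beta$ is defined when $s(\alpha)=r(\beta)$. Write $v\Lambda^n w=\{\lambda\in\Lambda^n: r(\lambda)=v,\ s(\lambda)=w\}$, and similarly $v\Lambda w$, $v\Lambda^n$. $\Lambda$ is finite if every $\Lambda^n$ is finite; strongly connected if $v\Lambda w\neq\emptyset$ for all $v,w\in\Lambda^0$; it has no sources if $v\Lambda^{e_i}\ne\emptyset$ for all $v\in\Lambda^0$, $1\le i\le k$. $\Omega_k=\{(p,q)\in\mathbb{N}^k\times\mathbb{N}^k: p\le q\}$ is the $k$-graph with $r(p,q)=p$, $s(p,q)=q$, $(p,q)(q,m)=(p,m)$, $d(p,q)=q-p$. An infinite path is a degree-preserving functor $x:\Omega_k\to\Lambda$; $\Lambda^\infty$ is the set of infinite paths. For $\lambda\in\Lambda$, $Z(\lambda)=\{x\in\Lambda^\infty: x(0,d(\lambda))=\lambda\}$; these cylinder sets generate the compact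 topology of $\Lambda^\infty$. $\Theta_\lambda$ denotes the characteristic function of $Z(\lambda)$. For $p\in\mathbb{N}^k$, the shift $\sigma^p:\Lambda^\infty\to\Lambda^\infty$ is $\sigma^p(x)(m,n)=x(m+p,n+p)$. The vertex matrices are $A_i(v,w)=|v\Lambda^{e_i}w|$, $1\le i\le k$; $\rho(A_i)$ is the spectral radius, $\rho(\Lambda)=(\rho(A_1),\dots,\rho(A_k))$, and for $n\in\mathbb{Z}^k$ (or $n\in\mathbb{R}^k$), $\rho(\Lambda)^n=\prod_i\rho(A_i)^{n_i}$. For $\Lambda$ finite and strongly connected, $x^\Lambda\in(0,\infty)^{\Lambda^0}$ is the unique common eigenvector of the $A_i$ with positive entries and $\ell^1$-norm $1$ (Perron-Frobenius eigenvector; $A_ix^\Lambda=\rho(A_i)x^\Lambda$). The Perron-Frobenius measure $M$ is the unique Borel probability measure on $\Lambda^\infty$ with $M(Z(\lambda))=\rho(\Lambda)^{-d(\lambda)}x^\Lambda_{s(\lambda)}$ for all $\lambda\in\Lambda$. The functions $f^{m,v}$: for $v\in\Lambda^0$ equip $\mathbb{C}^{D_v^J}$ (of dimension $d_v^J$) with the inner product $\langle\vec a,\vec b\rangle=\sum_{\lambda\in D_v^J}\overline{a_\lambda}\,b_\lambda\,\rho(\Lambda)^{-J}x^\Lambda_{s(\lambda)}$, and let $\{c^{m,v}\}_{m=1}^{d_v^J-1}$, $c^{m,v}=(c^{m,v}_\lambda)_{\lambda\in D_v^J}$, be any orthonormal basis, with respect to this inner product, of the orthogonal complement of $(1,\dots,1)$.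 Then $f^{m,v}=\sum_{\lambda\in D_v^J}c^{m,v}_\lambda\Theta_\lambda$. *)

theory Defs
  imports "HOL-Analysis.Analysis" "HOL-Probability.Probability_Measure" "Jordan_Normal_Form.Spectral_Radius"
begin

no_notation Matrix.vec_index (infixl "$" 100)

text \<open>
  A category is given by its morphisms only: an object is identified with its identity
  morphism, so range and source take values in \<^term>\<open>mor G\<close>.  The composite
  \<open>cmp G \<alpha> \<beta>\<close> is meaningful only when \<open>src G \<alpha> = rng G \<beta>\<close>.
  The rank \<open>k\<close> is the cardinality of the (nonempty, finite) index type \<open>'k\<close>; the order and
  the addition on \<open>nat ^ 'k\<close> are the coordinatewise ones.
\<close>

record ('a, 'k) graph_data =
  mor :: "'a set"
  dg  :: "'a \<Rightarrow> nat ^ 'k"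
  rng :: "'a \<Rightarrow> 'a"
  src :: "'a \<Rightarrow> 'a"
  cmp :: "'a \<Rightarrow> 'a \<Rightarrow> 'a"

locale k_graph =
  fixes G :: "('a, 'k::finite) graph_data"
  assumes countable_mor: "countable (mor G)"
    and rng_mor: "l \<in> mor G \<Longrightarrow> rng G l \<in> mor G"
    and src_mor: "l \<in> mor G \<Longrightarrow> src G l \<in> mor G"
    and rng_rng: "l \<in> mor G \<Longrightarrow> rng G (rng G l) = rng G l"
    and src_rng: "l \<in> mor G \<Longrightarrow> src G (rng G l) = rng G l"
    and rng_src: "l \<in> mor G \<Longrightarrow> rng G (src G l) = src G l"
    and src_src: "l \<in> mor G \<Longrightarrow> src G (src G l) = src G l"
    and cmp_mor: "\<lbrakk>\<alpha> \<in> mor G; \<beta> \<in> mor G; src G \<alpha> = rng G \<beta>\<rbrakk> \<Longrightarrow> cmp G \<alpha> \<beta> \<in> mor G"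
    and rng_cmp: "\<lbrakk>\<alpha> \<in> mor G; \<beta> \<in> mor G; src G \<alpha> = rng G \<beta>\<rbrakk> \<Longrightarrow> rng G (cmp G \<alpha> \<beta>) = rng G \<alpha>"
    and src_cmp: "\<lbrakk>\<alpha> \<in> mor G; \<beta> \<in> mor G; src G \<alpha> = rng G \<beta>\<rbrakk> \<Longrightarrow> src G (cmp G \<alpha> \<beta>) = src G \<beta>"
    and cmp_assoc: "\<lbrakk>\<alpha> \<in> mor G; \<beta> \<in> mor G; \<gamma> \<in> mor G; src G \<alpha> = rng G \<beta>; src G \<beta> = rng G \<gamma>\<rbrakk>
          \<Longrightarrow> cmp G (cmp G \<alpha> \<beta>) \<gamma> = cmp G \<alpha> (cmp G \<beta> \<gamma>)"
    and cmp_rng: "l \<in> mor G \<Longrightarrow> cmp G (rng G l) l = l"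
    and cmp_src: "l \<in> mor G \<Longrightarrow> cmp G l (src G l) = l"
    and dg_rng: "l \<in> mor G \<Longrightarrow> dg G (rng G l) = 0"
    and dg_src: "l \<in> mor G \<Longrightarrow> dg G (src G l) = 0"
    and dg_cmp: "\<lbrakk>\<alpha> \<in> mor G; \<beta> \<in> mor G; src G \<alpha> = rng G \<beta>\<rbrakk> \<Longrightarrow> dg G (cmp G \<alpha> \<beta>) = dg G \<alpha> + dg G \<beta>"
    and factorization: "\<lbrakk>l \<in> mor G; dg G l = m + n\<rbrakk> \<Longrightarrow>
          \<exists>!(\<alpha>, \<beta>). \<alpha> \<in> mor G \<and> \<beta> \<in> mor G \<and> src G \<alpha> = rng G \<beta> \<and>
                    dg G \<alpha> = m \<and> dg G \<beta> = n \<and> cmp G \<alpha> \<beta> = l"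

definition mor_deg :: "('a, 'k::finite) graph_data \<Rightarrow> nat ^ 'k \<Rightarrow> 'a set" where
  "mor_deg G n = {l \<in> mor G. dg G l = n}"

definition verts :: "('a, 'k::finite) graph_data \<Rightarrow> 'a set" where
  "verts G = mor_deg G 0"

definition finite_graph :: "('a, 'k::finite) graph_data \<Rightarrow> bool" where
  "finite_graph G \<longleftrightarrow> (\<forall>n. finite (mor_deg G n))"

definition strongly_connected :: "('a, 'k::finite) graph_data \<Rightarrow> bool" where
  "strongly_connected G \<longleftrightarrow>
     (\<forall>v \<in> verts G. \<forall>w \<in> verts G. \<exists>l \<in> mor G. rng G l = v \<and> src G l = w)"

definition no_sources :: "('a, 'k::finite) graph_data \<Rightarrow> bool" where
  "no_sources G \<longleftrightarrow> (\<forall>v \<in> verts G. \<forall>i. \<exists>l \<in> mor_deg G (axis i 1). rng G l = v)"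

definition Omega :: "((nat ^ 'k) \<times> (nat ^ 'k), 'k::finite) graph_data" where
  "Omega = \<lparr>mor = {(p, q). p \<le> q},
            dg  = (\<lambda>(p, q). q - p),
            rng = (\<lambda>(p, q). (p, p)),
            src = (\<lambda>(p, q). (q, q)),
            cmp = (\<lambda>(p, q) (q', m). (p, m))\<rparr>"

definition degree_functor ::
  "('b, 'k::finite) graph_data \<Rightarrow> ('a, 'k) graph_data \<Rightarrow> ('b \<Rightarrow> 'a) \<Rightarrow> bool" where
  "degree_functor H G x \<longleftrightarrow>
     (\<forall>a \<in> mor H. x a \<in> mor G \<and> dg G (x a) = dg H a \<and>
        rng G (x a) = x (rng H a) \<and> src G (x a) = x (src H a)) \<and>
     (\<forall>a \<in> mor H. \<forall>b \<in> mor H. src H a = rng H b \<longrightarrow> x (cmp H a b) = cmp G (x a) (x b))"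

type_synonym ('a, 'k) path = "(nat ^ 'k) \<times> (nat ^ 'k) \<Rightarrow> 'a"

text \<open>Infinite paths are taken extensional (i.e. \<^term>\<open>undefined\<close> off \<^term>\<open>mor Omega\<close>), so that
  equal functors are equal as HOL functions.\<close>

definition inf_paths :: "('a, 'k::finite) graph_data \<Rightarrow> ('a, 'k) path set" where
  "inf_paths G = {x \<in> extensional (mor Omega). degree_functor Omega G x}"

definition cylinder :: "('a, 'k::finite) graph_data \<Rightarrow> 'a \<Rightarrow> ('a, 'k) path set" where
  "cylinder G l = {x \<in> inf_paths G. x (0, dg G l) = l}"

definition path_topology :: "('a, 'k::finite) graph_data \<Rightarrow> ('a, 'k) path topology" where
  "path_topology G = topology_generated_by (cylinder G ` mor G)"

definition Theta :: "('a, 'k::finite) graph_data \<Rightarrow> 'a \<Rightarrow> ('a, 'k) path \<Rightarrow> complex" where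
  "Theta G l = indicator (cylinder G l)"

definition shift :: "nat ^ 'k::finite \<Rightarrow> ('a, 'k) path \<Rightarrow> ('a, 'k) path" where
  "shift p x = restrict (\<lambda>(m, n). x (m + p, n + p)) (mor Omega)"

definition vertex_matrix :: "('a, 'k::finite) graph_data \<Rightarrow> 'k \<Rightarrow> 'a \<Rightarrow> 'a \<Rightarrow> nat" where
  "vertex_matrix G i v w = card {l \<in> mor_deg G (axis i 1). rng G l = v \<and> src G l = w}"

text \<open>Matrices in the library are indexed by \<open>{0..<n}\<close>, hence the enumeration
  \<^term>\<open>from_nat_into (verts G)\<close> of the finite vertex set.\<close>

definition vertex_mat :: "('a, 'k::finite) graph_data \<Rightarrow> 'k \<Rightarrow> complex mat" where
  "vertex_mat G i = mat (card (verts G)) (card (verts G))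
     (\<lambda>(a, b). of_nat (vertex_matrix G i (from_nat_into (verts G) a) (from_nat_into (verts G) b)))"

definition rho :: "('a, 'k::finite) graph_data \<Rightarrow> 'k \<Rightarrow> real" where
  "rho G i = spectral_radius (vertex_mat G i)"

definition rho_pow :: "('a, 'k::finite) graph_data \<Rightarrow> real ^ 'k \<Rightarrow> real" where
  "rho_pow G n = (\<Prod>i\<in>UNIV. rho G i powr (n $ i))"

definition real_deg :: "nat ^ 'k \<Rightarrow> real ^ 'k::finite" where
  "real_deg n = (\<chi> i. real (n $ i))"

text \<open>\<open>pf_eigenvector G xv\<close> and \<open>pf_measure G xv M\<close> are the defining properties of the (unique)
  Perron-Frobenius eigenvector and measure.\<close>

definition pf_eigenvector :: "('a, 'k::finite) graph_data \<Rightarrow> ('a \<Rightarrow> real) \<Rightarrow> bool" where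
  "pf_eigenvector G xv \<longleftrightarrow>
     (\<forall>v \<in> verts G. xv v > 0) \<and>
     (\<Sum>v\<in>verts G. \<bar>xv v\<bar>) = 1 \<and>
     (\<forall>i. \<forall>v \<in> verts G. (\<Sum>w\<in>verts G. real (vertex_matrix G i v w) * xv w) = rho G i * xv v)"

definition pf_measure ::
  "('a, 'k::finite) graph_data \<Rightarrow> ('a \<Rightarrow> real) \<Rightarrow> ('a, 'k) path measure \<Rightarrow> bool" where
  "pf_measure G xv M \<longleftrightarrow>
     space M = inf_paths G \<and>
     sets M = sigma_sets (inf_paths G) {U. openin (path_topology G) U} \<and>
     prob_space M \<and>
     (\<forall>l \<in> mor G. measure M (cylinder G l) = rho_pow G (- real_deg (dg G l)) * xv (src G l))"

text \<open>
  Elements of the Hilbert space are represented by functions rather than by classes modulo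
  equality almost everywhere.  Inner products, norms and closed spans depend on functions only through their classes;
  in particular a closed span is closed under equality almost everywhere.
\<close>

definition L2 :: "'x measure \<Rightarrow> ('x \<Rightarrow> complex) set" where
  "L2 M = {f \<in> borel_measurable M. integrable M (\<lambda>x. (cmod (f x))\<^sup>2)}"

definition L2_inner :: "'x measure \<Rightarrow> ('x \<Rightarrow> complex) \<Rightarrow> ('x \<Rightarrow> complex) \<Rightarrow> complex" where
  "L2_inner M f g = (LINT x|M. f x * cnj (g x))"

definition L2_norm :: "'x measure \<Rightarrow> ('x \<Rightarrow> complex) \<Rightarrow> real" where
  "L2_norm M f = sqrt (LINT x|M. (cmod (f x))\<^sup>2)"

definition orthonormal_family :: "'x measure \<Rightarrow> 'i set \<Rightarrow> ('i \<Rightarrow> 'x \<Rightarrow> complex) \<Rightarrow> bool" where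
  "orthonormal_family M I u \<longleftrightarrow>
     (\<forall>i \<in> I. u i \<in> L2 M) \<and>
     (\<forall>i \<in> I. \<forall>j \<in> I. L2_inner M (u i) (u j) = (if i = j then 1 else 0))"

definition lin_span :: "('x \<Rightarrow> complex) set \<Rightarrow> ('x \<Rightarrow> complex) set" where
  "lin_span B = {(\<lambda>x. \<Sum>b\<in>F. a b * b x) | F a. finite F \<and> F \<subseteq> B}"

text \<open>The intersection with \<^term>\<open>L2 M\<close> keeps the Bochner integral in \<^const>\<open>L2_norm\<close> from
  taking its default value \<open>0\<close>; it has no effect when \<open>B \<subseteq> L2 M\<close>.\<close>

definition closed_span :: "'x measure \<Rightarrow> ('x \<Rightarrow> complex) set \<Rightarrow> ('x \<Rightarrow> complex) set" where
  "closed_span M B =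
     {g \<in> L2 M. \<forall>\<epsilon>>0. \<exists>h \<in> lin_span B \<inter> L2 M. L2_norm M (\<lambda>x. g x - h x) < \<epsilon>}"

text \<open>\<open>X\<close> is the Hilbert space direct sum of the (closed) subspaces \<open>E 0, E 1, \<dots>\<close>; the
  uniqueness of the components up to equality almost everywhere follows from orthogonality.\<close>

definition is_hilbert_sum ::
  "'x measure \<Rightarrow> ('x \<Rightarrow> complex) set \<Rightarrow> (nat \<Rightarrow> ('x \<Rightarrow> complex) set) \<Rightarrow> bool" where
  "is_hilbert_sum M X E \<longleftrightarrow>
     (\<forall>n. E n \<subseteq> L2 M) \<and>
     (\<forall>m n. m \<noteq> n \<longrightarrow> (\<forall>f \<in> E m. \<forall>g \<in> E n. L2_inner M f g = 0)) \<and>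
     X = {g \<in> L2 M. \<exists>h. (\<forall>n. h n \<in> E n) \<and>
            (\<lambda>N. L2_norm M (\<lambda>x. g x - (\<Sum>n<N. h n x))) \<longlonglongrightarrow> 0}"

definition Dset :: "('a, 'k::finite) graph_data \<Rightarrow> nat ^ 'k \<Rightarrow> 'a \<Rightarrow> 'a set" where
  "Dset G J v = {l \<in> mor G. dg G l = J \<and> rng G l = v}"

definition Cset :: "('a, 'k::finite) graph_data \<Rightarrow> nat ^ 'k \<Rightarrow> nat \<Rightarrow> 'a \<Rightarrow> 'a set" where
  "Cset G J j v = {l \<in> mor G. src G l = v \<and> dg G l = j *s J}"

definition coeff_inner ::
  "('a, 'k::finite) graph_data \<Rightarrow> ('a \<Rightarrow> real) \<Rightarrow> nat ^ 'k \<Rightarrow> 'a \<Rightarrow> ('a \<Rightarrow> complex) \<Rightarrow> ('a \<Rightarrow> complex) \<Rightarrow> complex"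
  where
  "coeff_inner G xv J v a b =
     (\<Sum>l\<in>Dset G J v. cnj (a l) * b l * of_real (rho_pow G (- real_deg J) * xv (src G l)))"

text \<open>\<open>c 1, \<dots>, c (d - 1)\<close>, with \<open>d = card (Dset G J v)\<close>, is an orthonormal basis of the orthogonal
  complement of \<open>(1, \<dots>, 1)\<close> in the space of vectors indexed by \<^term>\<open>Dset G J v\<close>; values off
  \<^term>\<open>Dset G J v\<close> are irrelevant.\<close>

definition wavelet_coeffs ::
  "('a, 'k::finite) graph_data \<Rightarrow> ('a \<Rightarrow> real) \<Rightarrow> nat ^ 'k \<Rightarrow> 'a \<Rightarrow> (nat \<Rightarrow> 'a \<Rightarrow> complex) \<Rightarrow> bool" where
  "wavelet_coeffs G xv J v c \<longleftrightarrow>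
     (\<forall>m \<in> {1..card (Dset G J v) - 1}. coeff_inner G xv J v (\<lambda>_. 1) (c m) = 0) \<and>
     (\<forall>m \<in> {1..card (Dset G J v) - 1}. \<forall>m' \<in> {1..card (Dset G J v) - 1}.
        coeff_inner G xv J v (c m) (c m') = (if m = m' then 1 else 0)) \<and>
     (\<forall>b. coeff_inner G xv J v (\<lambda>_. 1) b = 0 \<longrightarrow>
        (\<exists>t. \<forall>l \<in> Dset G J v. b l = (\<Sum>m = 1..card (Dset G J v) - 1. t m * c m l)))"

definition wavelet_f ::
  "('a, 'k::finite) graph_data \<Rightarrow> nat ^ 'k \<Rightarrow> ('a \<Rightarrow> nat \<Rightarrow> 'a \<Rightarrow> complex) \<Rightarrow> nat \<Rightarrow> 'a \<Rightarrow>
   ('a, 'k) path \<Rightarrow> complex" where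
  "wavelet_f G J c m v x = (\<Sum>l\<in>Dset G J v. c v m l * Theta G l x)"

definition Sop :: "('a, 'k::finite) graph_data \<Rightarrow> 'a \<Rightarrow> (('a, 'k) path \<Rightarrow> complex) \<Rightarrow>
   ('a, 'k) path \<Rightarrow> complex" where
  "Sop G l \<xi> x = Theta G l x * of_real (rho_pow G ((1 / 2) *\<^sub>R real_deg (dg G l))) * \<xi> (shift (dg G l) x)"

definition V0 :: "('a, 'k::finite) graph_data \<Rightarrow> ('a, 'k) path measure \<Rightarrow> (('a, 'k) path \<Rightarrow> complex) set"
  where "V0 G M = closed_span M (Theta G ` verts G)"

definition W ::
  "('a, 'k::finite) graph_data \<Rightarrow> ('a, 'k) path measure \<Rightarrow> nat ^ 'k \<Rightarrow> ('a \<Rightarrow> nat \<Rightarrow> 'a \<Rightarrow> complex) \<Rightarrow> nat \<Rightarrow>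
   (('a, 'k) path \<Rightarrow> complex) set" where
  "W G M J c j = closed_span M
     (if j = 0
      then {wavelet_f G J c m v | v m. v \<in> verts G \<and> m \<in> {1..card (Dset G J v) - 1}}
      else {Sop G l (wavelet_f G J c m v) | v l m.
              v \<in> verts G \<and> l \<in> Cset G J j v \<and> m \<in> {1..card (Dset G J v) - 1}})"

definition SJ :: "('a, 'k::finite) graph_data \<Rightarrow> nat ^ 'k \<Rightarrow> (('a, 'k) path \<Rightarrow> complex) set" where
  "SJ G J = {Theta G l | l. l \<in> mor G \<and> (\<exists>n. dg G l = n *s J)}"

lemma Omega_k_graph: "k_graph (Omega :: ((nat ^ 'k) \<times> (nat ^ 'k), 'k::finite) graph_data)"
proof
  show "countable (mor (Omega :: ((nat ^ 'k) \<times> (nat ^ 'k), 'k) graph_data))"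
    by (rule countableI_type)
next
  fix l :: "(nat ^ 'k) \<times> (nat ^ 'k)" and m n :: "nat ^ 'k"
  assume l: "l \<in> mor Omega" "dg Omega l = m + n"
  obtain p q where pq: "l = (p, q)" by (cases l)
  have le: "p $ i \<le> q $ i" and qe: "q $ i - p $ i = m $ i + n $ i" for i
    using l pq by (auto simp: Omega_def Finite_Cartesian_Product.less_eq_vec_def Finite_Cartesian_Product.vec_eq_iff)
  then have qi: "q $ i = p $ i + m $ i + n $ i" for i
    by (metis add.assoc le_add_diff_inverse)
  show "\<exists>!(\<alpha>, \<beta>). \<alpha> \<in> mor Omega \<and> \<beta> \<in> mor Omega \<and> src Omega \<alpha> = rng Omega \<beta> \<and>
          dg Omega \<alpha> = m \<and> dg Omega \<beta> = n \<and> cmp Omega \<alpha> \<beta> = l"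
  proof (rule ex1I[of _ "((p, p + m), (p + m, q))"], goal_cases)
    case 1
    show ?case
      using qi by (auto simp: Omega_def pq Finite_Cartesian_Product.less_eq_vec_def Finite_Cartesian_Product.vec_eq_iff)
  next
    case (2 y)
    obtain a b c d where y: "y = ((a, b), (c, d))" by (metis prod.exhaust)
    have "a = p" "d = q" "b = c" and ab: "a \<le> b" "b - a = m"
      using 2 by (auto simp: y pq Omega_def)
    moreover have "b = a + m"
      using ab by (auto simp: Finite_Cartesian_Product.less_eq_vec_def Finite_Cartesian_Product.vec_eq_iff) (metis le_add_diff_inverse)
    ultimately show ?case by (simp add: y)
  qed
next
  fix a b :: "(nat ^ 'k) \<times> (nat ^ 'k)"
  assume "a \<in> mor Omega" "b \<in> mor Omega" "src Omega a = rng Omega b"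
  then show "dg Omega (cmp Omega a b) = dg Omega a + dg Omega b"
    by (auto simp: Omega_def Finite_Cartesian_Product.less_eq_vec_def Finite_Cartesian_Product.vec_eq_iff)
qed (auto simp: Omega_def)

lemma (in k_graph) identities_eq_verts:
  "rng G ` mor G = verts G" "src G ` mor G = verts G"
proof -
  have *: "rng G v = v \<and> src G v = v" if v: "v \<in> verts G" for v
  proof -
    have vm: "v \<in> mor G" and dv: "dg G v = 0" using v by (auto simp: verts_def mor_deg_def)
    have "dg G v = 0 + 0" using dv by simp
    from factorization[OF vm this]
    have "(rng G v, v) = (v, src G v)"
      by (rule ex1E) (use vm dv in \<open>auto simp: rng_mor src_mor src_rng rng_src dg_rng dg_src cmp_rng cmp_src\<close>)
    then show ?thesis by auto
  qed
  have "verts G \<subseteq> mor G" by (auto simp: verts_def mor_deg_def)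
  with * show "rng G ` mor G = verts G" "src G ` mor G = verts G"
    by (force simp: verts_def mor_deg_def rng_mor src_mor dg_rng dg_src)+
qed

end

theory Submission
  imports Defs
begin

text \<open>
  Let \<open>U\<^sub>n\<close> be the span of the functions \<open>\<Theta>\<^sub>l\<close> with \<open>d(l) = nJ\<close>.  Each cylinder set \<open>Z(l)\<close> is the
  disjoint union of the sets \<open>Z(l\<mu>)\<close> with \<open>\<mu> \<in> D\<^sub>v\<close>, \<open>v = s(l)\<close>, so \<open>U\<^sub>0 \<subseteq> U\<^sub>1 \<subseteq> \<dots>\<close>.  Call
  \<open>S\<^sub>l f\<^bsup>m,v\<^esup>\<close> with \<open>d(l) = jJ\<close> a wavelet of level \<open>j\<close>; at level \<open>0\<close> these are the \<open>f\<^bsup>m,v\<^esup>\<close>.  The point is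
  that the wavelets of level \<open>j\<close> form an orthonormal basis of the orthogonal complement of \<open>U\<^sub>j\<close> in
  \<open>U\<^sub>j\<^sub>+\<^sub>1\<close>, and that the union of the \<open>U\<^sub>n\<close> is dense.

  The Perron-Frobenius measure is self-similar: \<open>M(Z(l\<mu>)) = \<rho>(\<Lambda>)\<^bsup>-d(l)\<^esup> M(Z(\<mu>))\<close>.  Hence the functions
  that are constant on the parts \<open>Z(l\<mu>)\<close> of \<open>Z(l)\<close> and vanish elsewhere form a rescaled copy of the
  coefficient space over \<open>D\<^sub>v\<close> with its weighted inner product (\<open>L2_inner_step_function\<close>), and
  \<open>S\<^sub>l f\<^bsup>m,v\<^esup>\<close> is the copy of \<open>c\<^bsup>m,v\<^esup>\<close>, scaled to norm one (\<open>Sop_wavelet_f\<close>).  Three consequences follow.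

  First, wavelets of one level are orthonormal: for different \<open>l\<close> of the same degree the supports are
  disjoint, and for the same \<open>l\<close> the \<open>c\<^bsup>m,v\<^esup>\<close> are orthonormal.

  Secondly, a wavelet supported in \<open>Z(l)\<close> is orthogonal to \<open>\<Theta>\<^sub>\<beta>\<close> whenever \<open>d(\<beta>) \<le> d(l)\<close>: by unique
  factorization \<open>Z(l)\<close> lies inside \<open>Z(\<beta>)\<close> or is disjoint from it, and the wavelet has integral zero since
  \<open>c\<^bsup>m,v\<^esup>\<close> is orthogonal to \<open>(1, \<dots>, 1)\<close> (\<open>L2_inner_step_function_coarse\<close>).  Wavelets of lower level and the
  \<open>\<Theta>\<^sub>v\<close> are combinations of such \<open>\<Theta>\<^sub>\<beta>\<close>, so different levels are orthogonal.

  Thirdly, \<open>(1, \<dots>, 1)\<close> and the \<open>c\<^bsup>m,v\<^esup>\<close> span the coefficient space, so each \<open>\<Theta>\<^sub>l\<^sub>\<mu>\<close> is a combination of \<open>\<Theta>\<^sub>l\<close>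
  and wavelets (\<open>Theta_refined_in_span\<close>).  By induction, the \<open>\<Theta>\<^sub>v\<close> and the wavelets of the levels below
  \<open>n\<close> span \<open>U\<^sub>n\<close>.

  Density (\<open>L2_eq_closed_span_SJ\<close>) is measure theory.  Since all coordinates of \<open>J\<close> are positive, the
  cylinder sets of degree in \<open>\<nat>J\<close> form a countable base of the topology, and they are pairwise nested or
  disjoint; so they are an intersection-stable generator of the Borel sets, and a Dynkin argument
  applies.  Finally, all levels are finite-dimensional, and the partial sums of the orthogonal expansion are
  best approximations from the spaces \<open>U\<^sub>n\<close>, whose union is dense; so they converge
  (\<open>is_hilbert_sum_orthogonal_bases\<close>).
\<close>

section \<open>Square-integrable functions\<close>

lemma L2_measurable: "f \<in> L2 M \<Longrightarrow> f \<in> borel_measurable M"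
  by (simp add: L2_def)

lemma L2_add:
  assumes "f \<in> L2 M" "g \<in> L2 M"
  shows "(\<lambda>x. f x + g x) \<in> L2 M"
proof -
  note [measurable] = L2_measurable[OF assms(1)] L2_measurable[OF assms(2)]
  have bound: "(cmod (f x + g x))\<^sup>2 \<le> 2 * (cmod (f x))\<^sup>2 + 2 * (cmod (g x))\<^sup>2" for x
  proof -
    have "(cmod (f x + g x))\<^sup>2 \<le> (cmod (f x) + cmod (g x))\<^sup>2"
      by (intro power_mono norm_triangle_ineq) auto
    also have "\<dots> \<le> 2 * (cmod (f x))\<^sup>2 + 2 * (cmod (g x))\<^sup>2"
      using sum_squares_bound[of "cmod (f x)" "cmod (g x)"] by (simp add: power2_sum)
    finally show ?thesis .
  qed
  have "integrable M (\<lambda>x. (cmod (f x + g x))\<^sup>2)"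
    by (rule Bochner_Integration.integrable_bound[where f="\<lambda>x. 2 * (cmod (f x))\<^sup>2 + 2 * (cmod (g x))\<^sup>2"])
       (use assms bound in \<open>auto simp: L2_def\<close>)
  then show ?thesis by (simp add: L2_def)
qed

lemma L2_scale:
  assumes "f \<in> L2 M"
  shows "(\<lambda>x. a * f x) \<in> L2 M"
  using assms by (auto simp: L2_def norm_mult power_mult_distrib)

lemma L2_diff:
  assumes "f \<in> L2 M" "g \<in> L2 M"
  shows "(\<lambda>x. f x - g x) \<in> L2 M"
  using L2_add[OF assms(1) L2_scale[OF assms(2), of "-1"]] by simp

lemma L2_zero: "(\<lambda>x. 0) \<in> L2 M"
  by (simp add: L2_def)

lemma L2_sum:
  assumes "\<And>i. i \<in> I \<Longrightarrow> f i \<in> L2 M"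
  shows "(\<lambda>x. \<Sum>i\<in>I. f i x) \<in> L2 M"
  using assms
  by (induction I rule: infinite_finite_induct) (auto simp: L2_zero intro: L2_add)

lemma L2_integrable_mult_cnj:
  assumes "f \<in> L2 M" "g \<in> L2 M"
  shows "integrable M (\<lambda>x. f x * cnj (g x))"
proof -
  note [measurable] = L2_measurable[OF assms(1)] L2_measurable[OF assms(2)]
  have bound: "cmod (f x * cnj (g x)) \<le> (cmod (f x))\<^sup>2 + (cmod (g x))\<^sup>2" for x
    using sum_squares_bound[of "cmod (f x)" "cmod (g x)"]
      mult_nonneg_nonneg[of "cmod (f x)" "cmod (g x)"]
    by (simp add: norm_mult del: mult_nonneg_nonneg)
  have meas: "(\<lambda>x. f x * cnj (g x)) \<in> borel_measurable M"
    by (intro borel_measurable_times borel_measurable_continuous_on[where f=cnj]) (auto intro!: continuous_intros)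
  show ?thesis
    by (rule Bochner_Integration.integrable_bound[where f="\<lambda>x. (cmod (f x))\<^sup>2 + (cmod (g x))\<^sup>2"])
       (use assms bound meas in \<open>auto simp: L2_def\<close>)
qed

lemma L2_inner_add_left:
  "f \<in> L2 M \<Longrightarrow> g \<in> L2 M \<Longrightarrow> h \<in> L2 M \<Longrightarrow>
    L2_inner M (\<lambda>x. f x + g x) h = L2_inner M f h + L2_inner M g h"
  by (simp add: L2_inner_def distrib_right L2_integrable_mult_cnj)

lemma L2_inner_diff_left:
  "f \<in> L2 M \<Longrightarrow> g \<in> L2 M \<Longrightarrow> h \<in> L2 M \<Longrightarrow>
    L2_inner M (\<lambda>x. f x - g x) h = L2_inner M f h - L2_inner M g h"
  by (simp add: L2_inner_def left_diff_distrib L2_integrable_mult_cnj)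

lemma L2_inner_scale_left: "L2_inner M (\<lambda>x. a * f x) h = a * L2_inner M f h"
  by (simp add: L2_inner_def mult.assoc)

lemma L2_inner_commute: "L2_inner M f g = cnj (L2_inner M g f)"
proof -
  have "cnj (L2_inner M g f) = (LINT x|M. cnj (g x * cnj (f x)))"
    unfolding L2_inner_def by (rule Bochner_Integration.integral_cnj[symmetric])
  then show ?thesis by (simp add: L2_inner_def mult.commute)
qed

lemma L2_inner_sum_left:
  assumes "\<And>i. i \<in> I \<Longrightarrow> f i \<in> L2 M" "h \<in> L2 M"
  shows "L2_inner M (\<lambda>x. \<Sum>i\<in>I. f i x) h = (\<Sum>i\<in>I. L2_inner M (f i) h)"
  using assms
  by (simp add: L2_inner_def sum_distrib_right Bochner_Integration.integral_sum L2_integrable_mult_cnj)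

lemma L2_inner_diff_right:
  "f \<in> L2 M \<Longrightarrow> g \<in> L2 M \<Longrightarrow> h \<in> L2 M \<Longrightarrow>
    L2_inner M h (\<lambda>x. f x - g x) = L2_inner M h f - L2_inner M h g"
  by (subst (1 2 3) L2_inner_commute) (simp add: L2_inner_diff_left)

lemma L2_inner_scale_right: "L2_inner M h (\<lambda>x. a * f x) = cnj a * L2_inner M h f"
  by (subst (1 2) L2_inner_commute) (simp add: L2_inner_scale_left)

lemma L2_inner_sum_right:
  assumes "\<And>i. i \<in> I \<Longrightarrow> f i \<in> L2 M" "h \<in> L2 M"
  shows "L2_inner M h (\<lambda>x. \<Sum>i\<in>I. f i x) = (\<Sum>i\<in>I. L2_inner M h (f i))"
  by (subst (1 2) L2_inner_commute) (simp add: L2_inner_sum_left assms)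

lemma L2_inner_zero_commute: "L2_inner M f g = 0 \<Longrightarrow> L2_inner M g f = 0"
  by (subst L2_inner_commute) simp

lemma L2_norm_nonneg: "L2_norm M f \<ge> 0"
  by (simp add: L2_norm_def)

lemma L2_norm_power2: "(L2_norm M f)\<^sup>2 = (LINT x|M. (cmod (f x))\<^sup>2)"
  by (simp add: L2_norm_def)

lemma L2_inner_self: "L2_inner M f f = of_real ((L2_norm M f)\<^sup>2)"
  unfolding L2_inner_def L2_norm_power2 complex_norm_square[symmetric]
  by (rule integral_complex_of_real)

lemma L2_norm_scale: "L2_norm M (\<lambda>x. a * f x) = cmod a * L2_norm M f"
  by (simp add: L2_norm_def norm_mult power_mult_distrib real_sqrt_mult)

lemma L2_norm_add_power2:
  assumes "f \<in> L2 M" "g \<in> L2 M"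
  shows "(L2_norm M (\<lambda>x. f x + g x))\<^sup>2 = (L2_norm M f)\<^sup>2 + (L2_norm M g)\<^sup>2 + 2 * Re (L2_inner M f g)"
proof -
  note fg = L2_add[OF assms]
  have "complex_of_real ((L2_norm M (\<lambda>x. f x + g x))\<^sup>2) = L2_inner M (\<lambda>x. f x + g x) (\<lambda>x. f x + g x)"
    by (rule L2_inner_self[symmetric])
  also have "\<dots> = cnj (L2_inner M (\<lambda>x. f x + g x) f) + cnj (L2_inner M (\<lambda>x. f x + g x) g)"
    using assms fg by (subst L2_inner_add_left) (auto simp flip: L2_inner_commute)
  also have "\<dots> = L2_inner M f f + L2_inner M g g + (L2_inner M f g + cnj (L2_inner M f g))"
    using assms by (simp add: L2_inner_add_left flip: L2_inner_commute)
  finally have "complex_of_real ((L2_norm M (\<lambda>x. f x + g x))\<^sup>2) =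
      of_real ((L2_norm M f)\<^sup>2 + (L2_norm M g)\<^sup>2 + 2 * Re (L2_inner M f g))"
    by (simp add: L2_inner_self complex_add_cnj)
  then show ?thesis by (simp only: of_real_eq_iff)
qed

lemma L2_Cauchy_Schwarz:
  assumes f: "f \<in> L2 M" and g: "g \<in> L2 M"
  shows "cmod (L2_inner M f g) \<le> L2_norm M f * L2_norm M g"
proof -
  define I where "I = L2_inner M f g"
  \<comment> \<open>Expand \<open>\<parallel>f - s I g\<parallel>\<^sup>2 \<ge> 0\<close> for real \<open>s\<close>; the factor \<open>I\<close> makes the cross term real.\<close>
  have quad: "0 \<le> (L2_norm M f)\<^sup>2 + s\<^sup>2 * (cmod I)\<^sup>2 * (L2_norm M g)\<^sup>2 - 2 * s * (cmod I)\<^sup>2" for s :: real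
  proof -
    let ?a = "- of_real s * I"
    have "0 \<le> (L2_norm M (\<lambda>x. f x + ?a * g x))\<^sup>2" by simp
    also have "\<dots> = (L2_norm M f)\<^sup>2 + (cmod ?a * L2_norm M g)\<^sup>2 + 2 * Re (cnj ?a * I)"
      using f g by (simp only: L2_norm_add_power2 L2_scale L2_norm_scale L2_inner_scale_right I_def)
    also have "cnj ?a * I = of_real (- s * (cmod I)\<^sup>2)"
      unfolding of_real_mult complex_norm_square by simp
    finally show ?thesis by (simp add: norm_mult power_mult_distrib)
  qed
  have "(cmod I)\<^sup>2 \<le> (L2_norm M f * L2_norm M g)\<^sup>2"
  proof (cases "L2_norm M g = 0")
    case True
    have "I = 0"
    proof (rule ccontr)
      assume "I \<noteq> 0"
      with quad[of "((L2_norm M f)\<^sup>2 + 1) / (2 * (cmod I)\<^sup>2)"] True show False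
        by (simp add: field_simps)
    qed
    then show ?thesis by simp
  next
    case False
    then have "(1 / (L2_norm M g)\<^sup>2)\<^sup>2 * (cmod I)\<^sup>2 * (L2_norm M g)\<^sup>2 = (cmod I)\<^sup>2 / (L2_norm M g)\<^sup>2"
      by (simp add: power2_eq_square)
    with quad[of "1 / (L2_norm M g)\<^sup>2"] have "(cmod I)\<^sup>2 / (L2_norm M g)\<^sup>2 \<le> (L2_norm M f)\<^sup>2"
      by simp
    then show ?thesis using False by (simp add: divide_le_eq power_mult_distrib)
  qed
  then show ?thesis
    unfolding I_def by (rule power2_le_imp_le) (simp add: L2_norm_nonneg)
qed

lemma L2_norm_triangle:
  assumes f: "f \<in> L2 M" and g: "g \<in> L2 M"
  shows "L2_norm M (\<lambda>x. f x + g x) \<le> L2_norm M f + L2_norm M g"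
proof (rule power2_le_imp_le)
  have "Re (L2_inner M f g) \<le> L2_norm M f * L2_norm M g"
    using L2_Cauchy_Schwarz[OF f g] complex_Re_le_cmod order_trans by blast
  then show "(L2_norm M (\<lambda>x. f x + g x))\<^sup>2 \<le> (L2_norm M f + L2_norm M g)\<^sup>2"
    by (simp add: L2_norm_add_power2[OF f g] power2_sum)
qed (simp add: L2_norm_nonneg)

lemma L2_norm_triangle_sub:
  assumes "f \<in> L2 M" "g \<in> L2 M" "h \<in> L2 M"
  shows "L2_norm M (\<lambda>x. f x - h x) \<le> L2_norm M (\<lambda>x. f x - g x) + L2_norm M (\<lambda>x. g x - h x)"
  using L2_norm_triangle[OF L2_diff[OF assms(1,2)] L2_diff[OF assms(2,3)]] by simp

text \<open>The dominating function bounds the error \<open>f - s i\<close>, since it is the square of the error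
  that has to be integrated; square integrability of \<open>s i\<close> then comes from that of \<open>f\<close>.\<close>

lemma L2_dominated_convergence:
  assumes f: "f \<in> L2 M" and s: "\<And>i. s i \<in> borel_measurable M"
    and w: "integrable M (\<lambda>x. (w x)\<^sup>2)"
    and bound: "\<And>i x. x \<in> space M \<Longrightarrow> cmod (f x - s i x) \<le> w x"
    and lim: "\<And>x. x \<in> space M \<Longrightarrow> (\<lambda>i. s i x) \<longlonglongrightarrow> f x"
  shows "\<And>i. s i \<in> L2 M" "(\<lambda>i. L2_norm M (\<lambda>x. f x - s i x)) \<longlonglongrightarrow> 0"
proof -
  note [measurable] = L2_measurable[OF f] s
  have sq: "(cmod (f x - s i x))\<^sup>2 \<le> (w x)\<^sup>2" if "x \<in> space M" for x i
    using bound[OF that] by (intro power_mono) auto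
  have diff: "(\<lambda>x. f x - s i x) \<in> L2 M" for i
    unfolding L2_def
    by (auto intro!: Bochner_Integration.integrable_bound[OF w] AE_I2 simp: sq)
  show "s i \<in> L2 M" for i
    using L2_diff[OF f diff[of i]] by simp
  have "(\<lambda>i. LINT x|M. (cmod (f x - s i x))\<^sup>2) \<longlonglongrightarrow> (LINT x|M. 0)"
  proof (rule integral_dominated_convergence[OF _ _ w])
    show "AE x in M. (\<lambda>i. (cmod (f x - s i x))\<^sup>2) \<longlonglongrightarrow> 0"
    proof (rule AE_I2)
      fix x assume "x \<in> space M"
      from tendsto_diff[OF tendsto_const[of "f x"] lim[OF this]]
      have "(\<lambda>i. f x - s i x) \<longlonglongrightarrow> 0" by simp
      from tendsto_power[OF tendsto_norm[OF this], of 2]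
      show "(\<lambda>i. (cmod (f x - s i x))\<^sup>2) \<longlonglongrightarrow> 0" by simp
    qed
  qed (auto simp: sq)
  from tendsto_real_sqrt[OF this] show "(\<lambda>i. L2_norm M (\<lambda>x. f x - s i x)) \<longlonglongrightarrow> 0"
    by (simp add: L2_norm_def)
qed

section \<open>Spans and closed spans\<close>

lemma lin_span_base: "b \<in> B \<Longrightarrow> b \<in> lin_span B"
  unfolding lin_span_def by (auto intro!: exI[of _ "{b}"] exI[of _ "\<lambda>_. 1"])

lemma lin_span_zero: "(\<lambda>x. 0) \<in> lin_span B"
  unfolding lin_span_def by (auto intro!: exI[of _ "{}"])

lemma lin_span_scale:
  assumes "f \<in> lin_span B"
  shows "(\<lambda>x. c * f x) \<in> lin_span B"
proof -
  obtain F a where "finite F" "F \<subseteq> B" "f = (\<lambda>x. \<Sum>b\<in>F. a b * b x)"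
    using assms by (auto simp: lin_span_def)
  then show ?thesis unfolding lin_span_def
    by (auto intro!: exI[of _ F] exI[of _ "\<lambda>b. c * a b"] simp: sum_distrib_left mult.assoc)
qed

lemma lin_span_add:
  assumes "f \<in> lin_span B" "g \<in> lin_span B"
  shows "(\<lambda>x. f x + g x) \<in> lin_span B"
proof -
  obtain F a where F: "finite F" "F \<subseteq> B" "f = (\<lambda>x. \<Sum>b\<in>F. a b * b x)"
    using assms by (auto simp: lin_span_def)
  obtain F' a' where F': "finite F'" "F' \<subseteq> B" "g = (\<lambda>x. \<Sum>b\<in>F'. a' b * b x)"
    using assms by (auto simp: lin_span_def)
  let ?a = "\<lambda>b. (if b \<in> F then a b else 0) + (if b \<in> F' then a' b else 0)"
  have "f x + g x = (\<Sum>b\<in>F \<union> F'. ?a b * b x)" for x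
  proof -
    have "f x = (\<Sum>b\<in>F \<union> F'. (if b \<in> F then a b else 0) * b x)"
      unfolding F(3) using F(1) F'(1) by (intro sum.mono_neutral_cong_left) auto
    moreover have "g x = (\<Sum>b\<in>F \<union> F'. (if b \<in> F' then a' b else 0) * b x)"
      unfolding F'(3) using F(1) F'(1) by (intro sum.mono_neutral_cong_left) auto
    ultimately show ?thesis by (simp add: distrib_right sum.distrib)
  qed
  then show ?thesis unfolding lin_span_def
    using F F' by (auto intro!: exI[of _ "F \<union> F'"] exI[of _ ?a])
qed

lemma lin_span_diff:
  assumes "f \<in> lin_span B" "g \<in> lin_span B"
  shows "(\<lambda>x. f x - g x) \<in> lin_span B"
  using lin_span_add[OF assms(1) lin_span_scale[OF assms(2), of "-1"]] by simp

lemma lin_span_sum: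
  assumes "\<And>i. i \<in> I \<Longrightarrow> f i \<in> lin_span B"
  shows "(\<lambda>x. \<Sum>i\<in>I. f i x) \<in> lin_span B"
  using assms
  by (induction I rule: infinite_finite_induct) (auto intro: lin_span_add lin_span_zero)

lemma lin_span_mono: "B \<subseteq> C \<Longrightarrow> lin_span B \<subseteq> lin_span C"
  unfolding lin_span_def by blast

lemma lin_span_minimal:
  assumes "B \<subseteq> lin_span C"
  shows "lin_span B \<subseteq> lin_span C"
proof
  fix f assume "f \<in> lin_span B"
  then obtain F a where "F \<subseteq> B" "f = (\<lambda>x. \<Sum>b\<in>F. a b * b x)"
    by (auto simp: lin_span_def)
  with assms show "f \<in> lin_span C" by (auto intro!: lin_span_sum lin_span_scale)
qed

lemma lin_span_L2: "B \<subseteq> L2 M \<Longrightarrow> lin_span B \<subseteq> L2 M"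
  by (auto simp: lin_span_def intro!: L2_sum L2_scale)

lemma closed_span_L2: "closed_span M B \<subseteq> L2 M"
  by (auto simp: closed_span_def)

lemma closed_span_lin_span:
  assumes "g \<in> lin_span B" "B \<subseteq> L2 M"
  shows "g \<in> closed_span M B"
proof -
  have g: "g \<in> L2 M" using assms lin_span_L2 by blast
  then show ?thesis unfolding closed_span_def using assms
    by (auto intro!: bexI[of _ g] simp: L2_norm_def)
qed

lemma closed_span_closed:
  assumes g: "g \<in> L2 M"
    and approx: "\<And>\<epsilon>. \<epsilon> > 0 \<Longrightarrow> \<exists>h \<in> closed_span M B. L2_norm M (\<lambda>x. g x - h x) < \<epsilon>"
  shows "g \<in> closed_span M B"
  unfolding closed_span_def
proof (intro CollectI conjI allI impI g)
  fix \<epsilon> :: real assume "\<epsilon> > 0"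
  then obtain h where h: "h \<in> closed_span M B" "L2_norm M (\<lambda>x. g x - h x) < \<epsilon> / 2"
    using approx[of "\<epsilon> / 2"] by auto
  then obtain k where k: "k \<in> lin_span B \<inter> L2 M" "L2_norm M (\<lambda>x. h x - k x) < \<epsilon> / 2"
    using half_gt_zero[OF \<open>\<epsilon> > 0\<close>] unfolding closed_span_def by blast
  have "L2_norm M (\<lambda>x. g x - k x) < \<epsilon>"
    using L2_norm_triangle_sub[OF g, of h k] h k closed_span_L2[of M B] by force
  then show "\<exists>h\<in>lin_span B \<inter> L2 M. L2_norm M (\<lambda>x. g x - h x) < \<epsilon>" using k by blast
qed

lemma closed_span_limit:
  assumes g: "g \<in> L2 M" and s: "\<And>n. s n \<in> closed_span M B"
    and lim: "(\<lambda>n. L2_norm M (\<lambda>x. g x - s n x)) \<longlonglongrightarrow> 0"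
  shows "g \<in> closed_span M B"
proof (rule closed_span_closed[OF g])
  fix \<epsilon> :: real assume "\<epsilon> > 0"
  from order_tendstoD(2)[OF lim this] obtain n where "L2_norm M (\<lambda>x. g x - s n x) < \<epsilon>"
    by (auto simp: eventually_sequentially)
  then show "\<exists>h \<in> closed_span M B. L2_norm M (\<lambda>x. g x - h x) < \<epsilon>" using s by blast
qed

lemma closed_span_add:
  assumes f: "f \<in> closed_span M B" and g: "g \<in> closed_span M B"
  shows "(\<lambda>x. f x + g x) \<in> closed_span M B"
  unfolding closed_span_def
proof (intro CollectI conjI allI impI)
  have fg: "f \<in> L2 M" "g \<in> L2 M" using f g closed_span_L2 by blast+
  then show "(\<lambda>x. f x + g x) \<in> L2 M" by (rule L2_add)
  fix \<epsilon> :: real assume "\<epsilon> > 0"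
  then have "\<epsilon> / 2 > 0" by simp
  obtain h where h: "h \<in> lin_span B \<inter> L2 M" "L2_norm M (\<lambda>x. f x - h x) < \<epsilon> / 2"
    using f \<open>\<epsilon> / 2 > 0\<close> unfolding closed_span_def by blast
  obtain k where k: "k \<in> lin_span B \<inter> L2 M" "L2_norm M (\<lambda>x. g x - k x) < \<epsilon> / 2"
    using g \<open>\<epsilon> / 2 > 0\<close> unfolding closed_span_def by blast
  have "L2_norm M (\<lambda>x. f x + g x - (h x + k x)) < \<epsilon>"
    using L2_norm_triangle[OF L2_diff[of f M h] L2_diff[of g M k]] fg h k
    by (simp add: algebra_simps)
  then show "\<exists>h\<in>lin_span B \<inter> L2 M. L2_norm M (\<lambda>x. f x + g x - h x) < \<epsilon>"
    using h k by (intro bexI[of _ "\<lambda>x. h x + k x"]) (auto intro: lin_span_add L2_add)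
qed

lemma closed_span_scale:
  assumes f: "f \<in> closed_span M B"
  shows "(\<lambda>x. c * f x) \<in> closed_span M B"
  unfolding closed_span_def
proof (intro CollectI conjI allI impI)
  have fL: "f \<in> L2 M" using f closed_span_L2 by blast
  then show "(\<lambda>x. c * f x) \<in> L2 M" by (rule L2_scale)
  fix \<epsilon> :: real assume "\<epsilon> > 0"
  \<comment> \<open>The summand \<open>1\<close> in the denominator covers \<open>c = 0\<close>.\<close>
  then have "\<epsilon> / (cmod c + 1) > 0" by (simp add: add_nonneg_pos)
  then obtain h where h: "h \<in> lin_span B \<inter> L2 M" "L2_norm M (\<lambda>x. f x - h x) < \<epsilon> / (cmod c + 1)"
    using f unfolding closed_span_def by blast
  have "cmod c * L2_norm M (\<lambda>x. f x - h x) \<le> (cmod c + 1) * L2_norm M (\<lambda>x. f x - h x)"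
    by (intro mult_right_mono) (auto simp: L2_norm_nonneg)
  also have "\<dots> < \<epsilon>" using h(2) by (simp add: pos_less_divide_eq add_nonneg_pos mult.commute)
  finally have "L2_norm M (\<lambda>x. c * f x - c * h x) < \<epsilon>"
    using L2_norm_scale[of M c "\<lambda>x. f x - h x"] by (simp add: right_diff_distrib)
  then show "\<exists>h\<in>lin_span B \<inter> L2 M. L2_norm M (\<lambda>x. c * f x - h x) < \<epsilon>"
    using h by (intro bexI[of _ "\<lambda>x. c * h x"]) (auto intro: lin_span_scale L2_scale)
qed

lemma closed_span_zero: "(\<lambda>x. 0) \<in> closed_span M B"
  unfolding closed_span_def
  by (auto intro!: bexI[of _ "\<lambda>x. 0"] simp: L2_zero lin_span_zero L2_norm_def)

lemma closed_span_sum: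
  assumes "\<And>i. i \<in> I \<Longrightarrow> f i \<in> closed_span M B"
  shows "(\<lambda>x. \<Sum>i\<in>I. f i x) \<in> closed_span M B"
  using assms
  by (induction I rule: infinite_finite_induct) (auto intro: closed_span_add closed_span_zero)

lemma closed_span_mono_lin_span:
  assumes "B \<subseteq> lin_span C"
  shows "closed_span M B \<subseteq> closed_span M C"
  using lin_span_minimal[OF assms] unfolding closed_span_def by fast

text \<open>Members of a closed span are functions on a whole type, and \<open>L2 M\<close> sees their values on the
  underlying space of \<open>M\<close> only.  This allows an indicator of a subset of the space to be replaced by
  an expression that agrees with it there.\<close>

lemma closed_span_cong_space:
  assumes "f \<in> closed_span M B" "\<And>x. x \<in> space M \<Longrightarrow> g x = f x"
  shows "g \<in> closed_span M B"
proof -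
  have fL: "f \<in> L2 M" using assms(1) closed_span_L2 by blast
  have gL: "g \<in> L2 M" using fL assms(2) unfolding L2_def
    by (auto cong: measurable_cong Bochner_Integration.integrable_cong)
  have "L2_norm M (\<lambda>x. g x - f x) = 0"
    using assms(2) by (simp add: L2_norm_def cong: Bochner_Integration.integral_cong)
  then show ?thesis using assms(1)
    by (intro closed_span_limit[OF gL, of "\<lambda>_. f"]) auto
qed

lemma L2_inner_lin_span_zero:
  assumes "f \<in> L2 M" "B \<subseteq> L2 M" "\<And>b. b \<in> B \<Longrightarrow> L2_inner M f b = 0" "g \<in> lin_span B"
  shows "L2_inner M f g = 0"
proof -
  obtain F a where F: "F \<subseteq> B" "g = (\<lambda>x. \<Sum>b\<in>F. a b * b x)"
    using assms(4) by (auto simp: lin_span_def)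
  then show ?thesis using assms
    by (auto simp: L2_inner_scale_right L2_scale subset_iff L2_inner_sum_right intro!: sum.neutral)
qed

lemma L2_inner_closed_span_zero:
  assumes f: "f \<in> L2 M" and B: "B \<subseteq> L2 M" "\<And>b. b \<in> B \<Longrightarrow> L2_inner M f b = 0"
    and g: "g \<in> closed_span M B"
  shows "L2_inner M f g = 0"
proof (rule ccontr)
  assume "L2_inner M f g \<noteq> 0"
  then have pos: "cmod (L2_inner M f g) > 0" by simp
  have gL: "g \<in> L2 M" using g closed_span_L2 by blast
  \<comment> \<open>The bound from Cauchy-Schwarz has to be strict; the summand \<open>1\<close> covers \<open>\<parallel>f\<parallel> = 0\<close>.\<close>
  define e where "e = cmod (L2_inner M f g) / (L2_norm M f + 1)"
  have e: "e > 0" using pos L2_norm_nonneg[of M f] by (simp add: e_def)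
  then obtain h where h: "h \<in> lin_span B" "h \<in> L2 M" "L2_norm M (\<lambda>x. g x - h x) < e"
    using g unfolding closed_span_def by blast
  have "L2_inner M f g = L2_inner M f (\<lambda>x. g x - h x)"
    using L2_inner_diff_right[OF gL h(2) f] L2_inner_lin_span_zero[OF f B h(1)] by simp
  then have "cmod (L2_inner M f g) \<le> L2_norm M f * L2_norm M (\<lambda>x. g x - h x)"
    using L2_Cauchy_Schwarz[OF f L2_diff[OF gL h(2)]] by simp
  also have "\<dots> \<le> L2_norm M f * e"
    using h(3) by (intro mult_left_mono) (auto simp: L2_norm_nonneg)
  also have "\<dots> < (L2_norm M f + 1) * e" using e by simp
  also have "\<dots> = cmod (L2_inner M f g)"
    using L2_norm_nonneg[of M f] by (simp add: e_def)
  finally show False by simp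
qed

lemma closed_span_orthogonal:
  assumes B: "B \<subseteq> L2 M" and C: "C \<subseteq> L2 M"
    and orth: "\<And>b c. b \<in> B \<Longrightarrow> c \<in> C \<Longrightarrow> L2_inner M b c = 0"
    and f: "f \<in> closed_span M B" and g: "g \<in> closed_span M C"
  shows "L2_inner M f g = 0"
proof -
  have "L2_inner M f c = 0" if "c \<in> C" for c
  proof -
    have "L2_inner M c f = 0"
      using that C B orth by (intro L2_inner_closed_span_zero[OF _ B _ f]) (auto intro: L2_inner_zero_commute)
    then show ?thesis by (rule L2_inner_zero_commute)
  qed
  then show ?thesis
    using L2_inner_closed_span_zero[OF _ C _ g] f closed_span_L2 by blast
qed

section \<open>Hilbert sums of finite-dimensional levels\<close>

text \<open>As every level has a finite orthogonal basis, the projection \<open>P n g\<close> to level \<open>n\<close> is a finite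
  Fourier sum.  The sum of the first \<open>N\<close> projections is the best approximation of \<open>g\<close> from the
  span of the first \<open>N\<close> levels, and a linear combination of basis vectors involves only finitely
  many levels; so the error is eventually below that of any given linear combination.\<close>

lemma is_hilbert_sum_orthogonal_bases:
  fixes B :: "nat \<Rightarrow> ('x \<Rightarrow> complex) set"
  assumes fin: "\<And>n. finite (B n)" and L2: "\<And>n. B n \<subseteq> L2 M"
    and nz: "\<And>n b. b \<in> B n \<Longrightarrow> L2_inner M b b \<noteq> 0"
    and orth: "\<And>n b b'. b \<in> B n \<Longrightarrow> b' \<in> B n \<Longrightarrow> b \<noteq> b' \<Longrightarrow> L2_inner M b b' = 0"
    and orth_levels: "\<And>m n b b'. m < n \<Longrightarrow> b \<in> B m \<Longrightarrow> b' \<in> B n \<Longrightarrow> L2_inner M b b' = 0"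
  shows "is_hilbert_sum M (closed_span M (\<Union>n. B n)) (\<lambda>n. closed_span M (B n))"
proof -
  have levels: "L2_inner M b b' = 0" if "m \<noteq> n" "b \<in> B m" "b' \<in> B n" for m n b b'
    using that orth_levels[of m n b b'] orth_levels[of n m b' b]
    by (metis L2_inner_zero_commute linorder_neqE_nat)
  define P where "P n g = (\<lambda>x. \<Sum>b\<in>B n. (L2_inner M g b / L2_inner M b b) * b x)" for n g
  have P_span: "P n g \<in> lin_span (B n)" for n g
    unfolding P_def by (intro lin_span_sum lin_span_scale lin_span_base)
  have P_L2: "P n g \<in> L2 M" for n g
    using P_span lin_span_L2[OF L2] by blast
  have P_inner: "L2_inner M (P n g) b = (if n = m then L2_inner M g b else 0)"
    if b: "b \<in> B m" for n m g b
  proof -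
    have "L2_inner M (\<lambda>x. \<Sum>b'\<in>B n. a b' * b' x) b = (\<Sum>b'\<in>B n. a b' * L2_inner M b' b)" for a
      using b L2 by (subst L2_inner_sum_left) (auto simp: L2_inner_scale_left intro!: L2_scale)
    then have "L2_inner M (P n g) b = (\<Sum>b'\<in>B n. (L2_inner M g b' / L2_inner M b' b') * L2_inner M b' b)"
      unfolding P_def .
    also have "\<dots> = (if n = m then L2_inner M g b else 0)"
    proof (cases "n = m")
      case True
      then have "(\<Sum>b'\<in>B n. (L2_inner M g b' / L2_inner M b' b') * L2_inner M b' b) =
          (\<Sum>b'\<in>B n. if b' = b then L2_inner M g b else 0)"
        using b nz orth by (intro sum.cong) auto
      then show ?thesis using True b fin by simp
    next
      case False
      then show ?thesis using b levels[of n m _ b] by (auto intro!: sum.neutral)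
    qed
    finally show ?thesis .
  qed
  have "closed_span M (\<Union>n. B n) = {g \<in> L2 M. \<exists>h. (\<forall>n. h n \<in> closed_span M (B n)) \<and>
            (\<lambda>N. L2_norm M (\<lambda>x. g x - (\<Sum>n<N. h n x))) \<longlonglongrightarrow> 0}" (is "_ = ?R")
  proof (intro equalityI subsetI)
    fix g assume "g \<in> ?R"
    then obtain h where g: "g \<in> L2 M" and h: "\<And>n. h n \<in> closed_span M (B n)"
      and lim: "(\<lambda>N. L2_norm M (\<lambda>x. g x - (\<Sum>n<N. h n x))) \<longlonglongrightarrow> 0" by auto
    have "closed_span M (B n) \<subseteq> closed_span M (\<Union>n. B n)" for n
      by (intro closed_span_mono_lin_span) (auto intro: lin_span_base)
    with h have "(\<lambda>x. \<Sum>n<N. h n x) \<in> closed_span M (\<Union>n. B n)" for N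
      by (intro closed_span_sum) auto
    from closed_span_limit[OF g this lim] show "g \<in> closed_span M (\<Union>n. B n)" .
  next
    fix g assume g: "g \<in> closed_span M (\<Union>n. B n)"
    have gL: "g \<in> L2 M" using g closed_span_L2 by blast
    define Q where "Q N = (\<lambda>x. \<Sum>n<N. P n g x)" for N
    have Q_L2: "Q N \<in> L2 M" for N unfolding Q_def by (intro L2_sum P_L2)
    have Q_span: "Q N \<in> lin_span (\<Union>n<N. B n)" for N
      unfolding Q_def using P_span lin_span_mono[of "B _" "\<Union>n<N. B n"]
      by (intro lin_span_sum) blast
    \<comment> \<open>\<open>Q N\<close> is the orthogonal projection of \<open>g\<close>, hence its best approximation.\<close>
    have best: "L2_norm M (\<lambda>x. g x - Q N x) \<le> L2_norm M (\<lambda>x. g x - t x)"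
      if t: "t \<in> lin_span (\<Union>n<N. B n)" for t N
    proof (rule power2_le_imp_le)
      have sub: "(\<Union>n<N. B n) \<subseteq> L2 M" using L2 by blast
      have tL: "t \<in> L2 M" using t lin_span_L2[OF sub] by blast
      have r: "L2_inner M (\<lambda>x. g x - Q N x) b = 0" if b: "b \<in> (\<Union>n<N. B n)" for b
      proof -
        obtain m where m: "m < N" "b \<in> B m" using b by auto
        then have bL: "b \<in> L2 M" using L2 by blast
        have "L2_inner M (Q N) b = (\<Sum>n<N. L2_inner M (P n g) b)"
          unfolding Q_def by (intro L2_inner_sum_left P_L2 bL)
        also have "\<dots> = L2_inner M g b" using m by (simp add: P_inner[OF m(2)])
        finally show ?thesis by (simp add: L2_inner_diff_left gL Q_L2 bL)
      qed
      have "L2_inner M (\<lambda>x. g x - Q N x) (\<lambda>x. Q N x - t x) = 0"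
        by (rule L2_inner_lin_span_zero[OF L2_diff[OF gL Q_L2] sub r lin_span_diff[OF Q_span t]])
      with L2_norm_add_power2[OF L2_diff[OF gL Q_L2[of N]] L2_diff[OF Q_L2[of N] tL]]
      show "(L2_norm M (\<lambda>x. g x - Q N x))\<^sup>2 \<le> (L2_norm M (\<lambda>x. g x - t x))\<^sup>2" by simp
    qed (simp add: L2_norm_nonneg)
    have "(\<lambda>N. L2_norm M (\<lambda>x. g x - Q N x)) \<longlonglongrightarrow> 0"
    proof (rule LIMSEQ_I)
      fix \<epsilon> :: real assume "\<epsilon> > 0"
      then obtain t where t: "t \<in> lin_span (\<Union>n. B n)" "L2_norm M (\<lambda>x. g x - t x) < \<epsilon>"
        using g unfolding closed_span_def by blast
      then obtain F a where F: "finite F" "F \<subseteq> (\<Union>n. B n)" "t = (\<lambda>x. \<Sum>b\<in>F. a b * b x)"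
        by (auto simp: lin_span_def)
      then obtain lv where lv: "\<And>b. b \<in> F \<Longrightarrow> b \<in> B (lv b)"
        by (metis UN_E subsetD)
      \<comment> \<open>The element \<open>0\<close> is inserted because \<open>F\<close> may be empty.\<close>
      define N where "N = Suc (Max (insert 0 (lv ` F)))"
      have lvN: "lv b < N" if "b \<in> F" for b
        using that F(1) by (simp add: N_def le_imp_less_Suc)
      have "norm (L2_norm M (\<lambda>x. g x - Q n x) - 0) < \<epsilon>" if "n \<ge> N" for n
      proof -
        have "F \<subseteq> (\<Union>n'<n. B n')" using lv lvN that order_less_le_trans by blast
        then have "t \<in> lin_span (\<Union>n'<n. B n')" using F by (auto simp: lin_span_def)
        from best[OF this] t(2) show ?thesis by (simp add: L2_norm_nonneg)
      qed
      then show "\<exists>N. \<forall>n\<ge>N. norm (L2_norm M (\<lambda>x. g x - Q n x) - 0) < \<epsilon>" by blast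
    qed
    moreover have "P n g \<in> closed_span M (B n)" for n
      by (rule closed_span_lin_span[OF P_span L2])
    ultimately show "g \<in> ?R" using gL by (auto simp: Q_def intro!: exI[of _ "\<lambda>n. P n g"])
  qed
  then show ?thesis
    unfolding is_hilbert_sum_def
    using closed_span_L2 closed_span_orthogonal[OF L2 L2] levels by blast
qed

section \<open>Density from an intersection-stable generator\<close>

lemma (in finite_measure) indicator_L2:
  "A \<in> sets M \<Longrightarrow> (indicator A :: _ \<Rightarrow> complex) \<in> L2 M"
  unfolding L2_def
  by (auto intro!: integrable_const_bound[of _ 1] simp: indicator_def)

text \<open>The sets with indicator in the closed span form a Dynkin system, because disjoint unions are limits
  of partial sums in \<open>L2\<close> norm.  By the \<open>\<pi>\<close>-\<open>\<lambda>\<close> theorem it contains all measurable sets, hence the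
  closed span contains all simple functions, and these approximate any square-integrable function
  by dominated convergence.\<close>

lemma (in finite_measure) closed_span_indicators_eq_L2:
  assumes int_stable: "Int_stable \<E>" and \<E>: "\<E> \<subseteq> sets M"
    and gen: "sets M = sigma_sets (space M) \<E>"
    and ind: "\<And>A. A \<in> \<E> \<Longrightarrow> indicator A \<in> closed_span M B"
    and one: "indicator (space M) \<in> closed_span M B"
  shows "L2 M = closed_span M B"
proof (intro equalityI subsetI)
  have ind_all: "(indicator A :: _ \<Rightarrow> complex) \<in> closed_span M B" if "A \<in> sets M" for A
  proof -
    have "\<E> \<subseteq> Pow (space M)" using \<E> sets.sets_into_space by blast
    moreover have "A \<in> sigma_sets (space M) \<E>" using that gen by simp
    ultimately show ?thesis
    proof (induction A rule: sigma_sets_induct_disjoint[OF int_stable, consumes 2])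
      fix A assume "A \<in> \<E>"
      then show "indicator A \<in> closed_span M B" by (rule ind)
    next
      show "indicator {} \<in> closed_span M B"
        using closed_span_zero[of M B] by (rule closed_span_cong_space) simp
    next
      fix A assume A: "A \<in> sigma_sets (space M) \<E>" and IH: "(indicator A :: _ \<Rightarrow> complex) \<in> closed_span M B"
      have "(\<lambda>x. indicator (space M) x + -1 * indicator A x :: complex) \<in> closed_span M B"
        by (intro closed_span_add one closed_span_scale IH)
      then show "indicator (space M - A) \<in> closed_span M B"
        by (rule closed_span_cong_space) (auto simp: indicator_def)
    next
      fix A :: "nat \<Rightarrow> 'a set"
      assume disj: "disjoint_family A" and A: "range A \<subseteq> sigma_sets (space M) \<E>"
        and IH: "\<And>i. (indicator (A i) :: _ \<Rightarrow> complex) \<in> closed_span M B"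
      have As: "A i \<in> sets M" for i using A gen by auto
      have U: "(\<Union>i. A i) \<in> sets M" using As by auto
      let ?s = "\<lambda>n x. \<Sum>i<n. indicator (A i) x :: complex"
      have s_eq: "?s n x = indicator (\<Union>i<n. A i) x" for n x
        using disj by (subst indicator_UN_disjoint) (auto simp: disjoint_family_on_def)
      show "indicator (\<Union>i. A i) \<in> closed_span M B"
      proof (rule closed_span_limit[OF indicator_L2[OF U], of ?s])
        show "?s n \<in> closed_span M B" for n by (intro closed_span_sum IH)
        show "(\<lambda>n. L2_norm M (\<lambda>x. indicator (\<Union>i. A i) x - ?s n x)) \<longlonglongrightarrow> 0"
        proof (rule L2_dominated_convergence(2)[OF indicator_L2[OF U], where w="\<lambda>_. 1"])
          show "?s n \<in> borel_measurable M" for n using As by (intro borel_measurable_sum) auto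
          show "cmod (indicator (\<Union>i. A i) x - ?s n x) \<le> 1" for n x
            unfolding s_eq by (auto simp: indicator_def)
          show "(\<lambda>n. ?s n x) \<longlonglongrightarrow> indicator (\<Union>i. A i) x" for x
            unfolding s_eq by (rule LIMSEQ_indicator_UN)
        qed auto
      qed
    qed
  qed
  fix f assume f: "f \<in> L2 M"
  note [measurable] = L2_measurable[OF f]
  obtain s where s: "\<And>i. simple_function M (s i)"
    "\<And>x. x \<in> space M \<Longrightarrow> (\<lambda>i. s i x) \<longlonglongrightarrow> f x"
    "\<And>i x. x \<in> space M \<Longrightarrow> dist (s i x) 0 \<le> 2 * dist (f x) 0"
    using borel_measurable_implies_sequence_metric[OF L2_measurable[OF f], of 0] by metis
  have "(\<lambda>i. L2_norm M (\<lambda>x. f x - s i x)) \<longlonglongrightarrow> 0"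
  proof (rule L2_dominated_convergence(2)[OF f, where w="\<lambda>x. 3 * cmod (f x)"])
    show "s i \<in> borel_measurable M" for i using s(1) by (rule borel_measurable_simple_function)
    show "integrable M (\<lambda>x. (3 * cmod (f x))\<^sup>2)" using f by (simp add: L2_def power_mult_distrib)
    show "cmod (f x - s i x) \<le> 3 * cmod (f x)" if "x \<in> space M" for x i
      using norm_triangle_ineq4[of "f x" "s i x"] s(3)[OF that, of i] by simp
  qed (use s(2) in auto)
  moreover have "s i \<in> closed_span M B" for i
  proof (rule closed_span_cong_space)
    show "(\<lambda>x. \<Sum>y\<in>s i ` space M. y * indicator (s i -` {y} \<inter> space M) x) \<in> closed_span M B"
      using s(1)[of i] by (intro closed_span_sum closed_span_scale ind_all) (auto simp: simple_function_def)
    fix x assume x: "x \<in> space M"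
    have "(\<Sum>y\<in>s i ` space M. y * indicator (s i -` {y} \<inter> space M) x) =
        (\<Sum>y\<in>s i ` space M. if y = s i x then s i x else 0)"
      using x by (intro sum.cong) (auto simp: indicator_def)
    then show "s i x = (\<Sum>y\<in>s i ` space M. y * indicator (s i -` {y} \<inter> space M) x)"
      using x s(1)[of i] by (simp add: simple_function_def)
  qed
  ultimately show "f \<in> closed_span M B" by (intro closed_span_limit[OF f, of s])
qed (use closed_span_L2 in blast)

section \<open>Degrees\<close>

lemma vec_nat_diff_add: "p \<le> q \<Longrightarrow> p + (q - p) = (q :: nat ^ 'k::finite)"
  by (simp add: Finite_Cartesian_Product.less_eq_vec_def Finite_Cartesian_Product.vec_eq_iff)

lemma vec_nat_add_diff_cancel: "(m + p) - (n + p) = m - (n :: nat ^ 'k::finite)"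
  by (simp add: Finite_Cartesian_Product.vec_eq_iff)

lemma vec_nat_le_add: "p \<le> p + (q :: nat ^ 'k::finite)" "0 \<le> p"
  by (simp_all add: Finite_Cartesian_Product.less_eq_vec_def)

lemma vec_nat_add_le_cancel: "m + p \<le> n + p \<longleftrightarrow> m \<le> (n :: nat ^ 'k::finite)"
  by (simp add: Finite_Cartesian_Product.less_eq_vec_def)

lemma vec_nat_smult_mono: "m \<le> n \<Longrightarrow> m *s J \<le> n *s (J :: nat ^ 'k::finite)"
  by (simp add: Finite_Cartesian_Product.less_eq_vec_def)

lemma vec_nat_smult_Suc: "Suc n *s J = n *s J + (J :: nat ^ 'k::finite)"
  by (simp add: Finite_Cartesian_Product.vec_eq_iff)

lemma vec_nat_smult_zero: "0 *s J = (0 :: nat ^ 'k::finite)"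
  by (simp add: Finite_Cartesian_Product.vec_eq_iff)

text \<open>The multiples of a strictly positive \<open>J\<close> are cofinal among the degrees: this is what lets cylinder
  sets with degree a multiple of \<open>J\<close> replace all cylinder sets.\<close>

lemma vec_nat_le_smult:
  fixes J p :: "nat ^ 'k::finite"
  assumes "\<forall>i. J $ i > 0"
  shows "p \<le> (\<Sum>i\<in>UNIV. p $ i) *s J"
proof -
  have "p $ i \<le> (\<Sum>i\<in>UNIV. p $ i) * J $ i" for i
    using assms member_le_sum[of i UNIV "\<lambda>i. p $ i"]
    by (metis One_nat_def Suc_leI UNIV_I finite le0 mult.right_neutral mult_le_mono)
  then show ?thesis by (simp add: Finite_Cartesian_Product.less_eq_vec_def)
qed

section \<open>Infinite paths and cylinder sets\<close>

context k_graph
begin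

lemma vertD:
  assumes "v \<in> verts G"
  shows "v \<in> mor G" "dg G v = 0" "rng G v = v" "src G v = v"
proof -
  show "v \<in> mor G" "dg G v = 0" using assms by (auto simp: verts_def mor_deg_def)
  obtain l where l: "l \<in> mor G" "v = rng G l"
    using assms identities_eq_verts(1) by blast
  then show "rng G v = v" "src G v = v" by (auto simp: rng_rng src_rng)
qed

lemma src_verts: "l \<in> mor G \<Longrightarrow> src G l \<in> verts G"
  using identities_eq_verts(2) by blast

lemma factor_unique:
  assumes "\<alpha> \<in> mor G" "\<beta> \<in> mor G" "src G \<alpha> = rng G \<beta>"
    and "\<alpha>' \<in> mor G" "\<beta>' \<in> mor G" "src G \<alpha>' = rng G \<beta>'"
    and "dg G \<alpha> = dg G \<alpha>'" "cmp G \<alpha> \<beta> = cmp G \<alpha>' \<beta>'"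
  shows "\<alpha> = \<alpha>'" "\<beta> = \<beta>'"
proof -
  have d: "dg G (cmp G \<alpha> \<beta>) = dg G \<alpha> + dg G \<beta>" "dg G (cmp G \<alpha>' \<beta>') = dg G \<alpha>' + dg G \<beta>'"
    by (rule dg_cmp[OF assms(1-3)], rule dg_cmp[OF assms(4-6)])
  then have "dg G \<beta> = dg G \<beta>'" using assms(7,8) by simp
  define P where "P = (\<lambda>(\<gamma>, \<delta>). \<gamma> \<in> mor G \<and> \<delta> \<in> mor G \<and> src G \<gamma> = rng G \<delta> \<and>
    dg G \<gamma> = dg G \<alpha> \<and> dg G \<delta> = dg G \<beta> \<and> cmp G \<gamma> \<delta> = cmp G \<alpha> \<beta>)"
  have "\<exists>!y. P y"
    unfolding P_def by (rule factorization[OF cmp_mor[OF assms(1-3)] d(1)])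
  moreover have "P (\<alpha>, \<beta>)" "P (\<alpha>', \<beta>')"
    using assms \<open>dg G \<beta> = dg G \<beta>'\<close> by (simp_all add: P_def)
  ultimately have "(\<alpha>, \<beta>) = (\<alpha>', \<beta>')" by blast
  then show "\<alpha> = \<alpha>'" "\<beta> = \<beta>'" by auto
qed

lemma factor_obtain:
  assumes "l \<in> mor G" "dg G l = m + n"
  obtains \<alpha> \<beta> where "\<alpha> \<in> mor G" "\<beta> \<in> mor G" "src G \<alpha> = rng G \<beta>" "dg G \<alpha> = m" "dg G \<beta> = n"
    "cmp G \<alpha> \<beta> = l"
proof -
  from ex1_implies_ex[OF factorization[OF assms]] obtain y where
    y: "case y of (\<alpha>, \<beta>) \<Rightarrow> \<alpha> \<in> mor G \<and> \<beta> \<in> mor G \<and> src G \<alpha> = rng G \<beta> \<and>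
      dg G \<alpha> = m \<and> dg G \<beta> = n \<and> cmp G \<alpha> \<beta> = l" ..
  obtain \<alpha> \<beta> where "y = (\<alpha>, \<beta>)" by (cases y)
  with y show thesis by (intro that[of \<alpha> \<beta>]) simp_all
qed

lemma path_mor:
  assumes "x \<in> inf_paths G" "p \<le> q"
  shows "x (p, q) \<in> mor G" "dg G (x (p, q)) = q - p"
    "rng G (x (p, q)) = x (p, p)" "src G (x (p, q)) = x (q, q)"
proof -
  have "degree_functor Omega G x" using assms by (simp add: inf_paths_def)
  moreover have "(p, q) \<in> mor Omega" using assms by (simp add: Omega_def)
  ultimately have "x (p, q) \<in> mor G \<and> dg G (x (p, q)) = dg Omega (p, q) \<and>
      rng G (x (p, q)) = x (rng Omega (p, q)) \<and> src G (x (p, q)) = x (src Omega (p, q))"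
    unfolding degree_functor_def by blast
  then show "x (p, q) \<in> mor G" "dg G (x (p, q)) = q - p"
    "rng G (x (p, q)) = x (p, p)" "src G (x (p, q)) = x (q, q)"
    by (simp_all add: Omega_def)
qed

lemma path_cmp:
  assumes "x \<in> inf_paths G" "p \<le> q" "q \<le> m"
  shows "cmp G (x (p, q)) (x (q, m)) = x (p, m)"
proof -
  have "degree_functor Omega G x" using assms by (simp add: inf_paths_def)
  then have "(p, q) \<in> mor Omega \<Longrightarrow> (q, m) \<in> mor Omega \<Longrightarrow> src Omega (p, q) = rng Omega (q, m) \<Longrightarrow>
      x (cmp Omega (p, q) (q, m)) = cmp G (x (p, q)) (x (q, m))"
    unfolding degree_functor_def by blast
  then show ?thesis using assms by (simp add: Omega_def)
qed

lemma shift_apply: "p \<le> q \<Longrightarrow> shift n x (p, q) = x (p + n, q + n)"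
  by (simp add: shift_def Omega_def)

lemma shift_inf_paths:
  assumes x: "x \<in> inf_paths G"
  shows "shift n x \<in> inf_paths G"
proof -
  have "shift n x \<in> extensional (mor Omega)" by (simp add: shift_def)
  moreover have "degree_functor Omega G (shift n x)"
    unfolding degree_functor_def
  proof (intro conjI ballI impI)
    fix a :: "(nat ^ 'k) \<times> (nat ^ 'k)" assume "a \<in> mor Omega"
    then obtain p q where a: "a = (p, q)" "p \<le> q" by (auto simp: Omega_def)
    then have "p + n \<le> q + n" by (simp add: vec_nat_add_le_cancel)
    from path_mor[OF x this] a
    show "shift n x a \<in> mor G" "dg G (shift n x a) = dg Omega a"
      "rng G (shift n x a) = shift n x (rng Omega a)" "src G (shift n x a) = shift n x (src Omega a)"
      by (simp_all add: shift_apply Omega_def vec_nat_add_diff_cancel)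
  next
    fix a b :: "(nat ^ 'k) \<times> (nat ^ 'k)"
    assume "a \<in> mor Omega" "b \<in> mor Omega" "src Omega a = rng Omega b"
    then obtain p q m where ab: "a = (p, q)" "b = (q, m)" "p \<le> q" "q \<le> m" by (auto simp: Omega_def)
    then have "p \<le> m" "p + n \<le> q + n" "q + n \<le> m + n" by (auto simp: vec_nat_add_le_cancel)
    with ab path_cmp[OF x, of "p + n" "q + n" "m + n"]
    show "shift n x (cmp Omega a b) = cmp G (shift n x a) (shift n x b)"
      by (simp add: shift_apply Omega_def)
  qed
  ultimately show ?thesis by (simp add: inf_paths_def)
qed

lemma cylinder_inf_paths: "cylinder G l \<subseteq> inf_paths G"
  by (auto simp: cylinder_def)

lemma path_in_cylinder:
  assumes "x \<in> inf_paths G"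
  shows "x (0, p) \<in> mor G" "dg G (x (0, p)) = p" "x \<in> cylinder G (x (0, p))"
  using path_mor[OF assms, of 0 p] assms by (auto simp: vec_nat_le_add cylinder_def)

lemma path_segments_composable:
  assumes "x \<in> inf_paths G"
  shows "src G (x (0, p)) = rng G (x (p, p + q))"
  using path_mor[OF assms, of 0 p] path_mor[OF assms, of p "p + q"] by (simp add: vec_nat_le_add)

lemma path_split:
  assumes "x \<in> inf_paths G"
  shows "x (0, p + q) = cmp G (x (0, p)) (x (p, p + q))"
  using path_cmp[OF assms, of 0 p "p + q"] by (simp add: vec_nat_le_add)

text \<open>A path starts with \<open>\<alpha>\<beta>\<close> iff it starts with \<open>\<alpha>\<close> and continues with \<open>\<beta>\<close>; unique factorization gives
  the forward direction.  It turns the operator \<open>S\<^sub>\<alpha>\<close> into a relabelling of cylinder sets.\<close>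

lemma cylinder_cmp:
  assumes ab: "\<alpha> \<in> mor G" "\<beta> \<in> mor G" "src G \<alpha> = rng G \<beta>"
  shows "x \<in> cylinder G (cmp G \<alpha> \<beta>) \<longleftrightarrow> x \<in> cylinder G \<alpha> \<and> shift (dg G \<alpha>) x \<in> cylinder G \<beta>"
proof (cases "x \<in> inf_paths G")
  case True
  let ?a = "dg G \<alpha>" and ?b = "dg G \<beta>"
  have sh: "shift ?a x (0, ?b) = x (?a, ?a + ?b)"
    by (simp add: shift_apply vec_nat_le_add add.commute)
  have "x (0, ?a + ?b) = cmp G \<alpha> \<beta> \<longleftrightarrow> x (0, ?a) = \<alpha> \<and> x (?a, ?a + ?b) = \<beta>"
  proof
    assume eq: "x (0, ?a + ?b) = cmp G \<alpha> \<beta>"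
    have "x (?a, ?a + ?b) \<in> mor G" by (rule path_mor(1)[OF True vec_nat_le_add(1)])
    note unique = factor_unique[OF path_in_cylinder(1)[OF True] this path_segments_composable[OF True] ab
        path_in_cylinder(2)[OF True] eq[unfolded path_split[OF True]]]
    show "x (0, ?a) = \<alpha> \<and> x (?a, ?a + ?b) = \<beta>" by (intro conjI unique)
  qed (simp add: path_split[OF True])
  then show ?thesis using True ab shift_inf_paths[OF True]
    by (auto simp: cylinder_def dg_cmp sh)
qed (auto simp: cylinder_def)

text \<open>All paths through \<open>Z(\<alpha>)\<close> have the same initial segment of degree \<open>d(\<beta>) \<le> d(\<alpha>)\<close>, namely the first
  factor of \<open>\<alpha>\<close>; it is either equal to \<open>\<beta>\<close> or not.\<close>

lemma cylinder_nested:
  assumes a: "\<alpha> \<in> mor G" and b: "\<beta> \<in> mor G" and le: "dg G \<beta> \<le> dg G \<alpha>"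
  shows "cylinder G \<alpha> \<subseteq> cylinder G \<beta> \<or> cylinder G \<alpha> \<inter> cylinder G \<beta> = {}"
proof -
  have "dg G \<alpha> = dg G \<beta> + (dg G \<alpha> - dg G \<beta>)" by (simp add: vec_nat_diff_add le)
  from factor_obtain[OF a this] obtain \<gamma> \<delta> where gd: "\<gamma> \<in> mor G" "\<delta> \<in> mor G"
    "src G \<gamma> = rng G \<delta>" "dg G \<gamma> = dg G \<beta>" "cmp G \<gamma> \<delta> = \<alpha>" by metis
  then have "cylinder G \<alpha> \<subseteq> cylinder G \<gamma>" using cylinder_cmp by blast
  moreover have "\<gamma> = \<beta> \<or> cylinder G \<gamma> \<inter> cylinder G \<beta> = {}"
    using gd(4) by (auto simp: cylinder_def)
  ultimately show ?thesis by blast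
qed

lemma initial_cylinders_antimono:
  assumes x: "x \<in> inf_paths G" and le: "p \<le> q"
  shows "cylinder G (x (0, q)) \<subseteq> cylinder G (x (0, p))"
proof -
  have "dg G (x (0, p)) \<le> dg G (x (0, q))" by (simp add: path_in_cylinder(2)[OF x] le)
  from cylinder_nested[OF path_in_cylinder(1)[OF x] path_in_cylinder(1)[OF x] this]
  show ?thesis using path_in_cylinder(3)[OF x, of p] path_in_cylinder(3)[OF x, of q] by blast
qed

lemma Theta_eq: "Theta G l x = (if x \<in> cylinder G l then 1 else 0)"
  by (simp add: Theta_def indicator_def)

lemma Theta_cmp:
  assumes "\<alpha> \<in> mor G" "\<beta> \<in> mor G" "src G \<alpha> = rng G \<beta>"
  shows "Theta G (cmp G \<alpha> \<beta>) x = Theta G \<alpha> x * Theta G \<beta> (shift (dg G \<alpha>) x)"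
  using cylinder_cmp[OF assms] by (simp add: Theta_eq)

text \<open>The cylinder set \<open>Z(\<alpha>)\<close> is the disjoint union of the sets \<open>Z(\<alpha>\<mu>)\<close> with \<open>d(\<mu>) = n\<close>: for
  \<open>x\<close> in \<open>Z(\<alpha>)\<close> the only \<open>\<mu>\<close> that contributes is the segment of \<open>x\<close> of degree \<open>n\<close> that follows \<open>\<alpha>\<close>.\<close>

lemma Theta_refine:
  assumes fin: "finite_graph G" and a: "\<alpha> \<in> mor G"
  shows "Theta G \<alpha> x = (\<Sum>\<mu>\<in>Dset G n (src G \<alpha>). Theta G (cmp G \<alpha> \<mu>) x)"
proof -
  have finD: "finite (Dset G n (src G \<alpha>))"
    using fin unfolding finite_graph_def Dset_def mor_deg_def by (metis (no_types, lifting) finite_subset mem_Collect_eq subsetI)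
  have "(\<Sum>\<mu>\<in>Dset G n (src G \<alpha>). Theta G (cmp G \<alpha> \<mu>) x) =
      (\<Sum>\<mu>\<in>Dset G n (src G \<alpha>). if \<mu> = shift (dg G \<alpha>) x (0, n) then Theta G \<alpha> x else 0)"
  proof (intro sum.cong refl)
    fix \<mu> assume "\<mu> \<in> Dset G n (src G \<alpha>)"
    then have mu: "\<mu> \<in> mor G" "dg G \<mu> = n" "src G \<alpha> = rng G \<mu>" by (auto simp: Dset_def)
    have "x \<in> cylinder G \<alpha> \<Longrightarrow> shift (dg G \<alpha>) x \<in> inf_paths G"
      using shift_inf_paths cylinder_inf_paths by blast
    then show "Theta G (cmp G \<alpha> \<mu>) x = (if \<mu> = shift (dg G \<alpha>) x (0, n) then Theta G \<alpha> x else 0)"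
      using mu a cylinder_cmp[OF a mu(1,3)] by (auto simp: Theta_eq cylinder_def[of _ \<mu>])
  qed
  also have "\<dots> = Theta G \<alpha> x"
  proof (cases "x \<in> cylinder G \<alpha>")
    case True
    then have x: "x \<in> inf_paths G" "x (0, dg G \<alpha>) = \<alpha>" by (auto simp: cylinder_def)
    have sh: "shift (dg G \<alpha>) x (0, n) = x (dg G \<alpha>, dg G \<alpha> + n)"
      by (simp add: shift_apply vec_nat_le_add add.commute)
    have "x (dg G \<alpha>, dg G \<alpha> + n) \<in> Dset G n (src G \<alpha>)"
      using path_mor[OF x(1), of "dg G \<alpha>" "dg G \<alpha> + n"] path_segments_composable[OF x(1), of "dg G \<alpha>" n] x(2)
      by (simp add: Dset_def vec_nat_le_add)
    then show ?thesis using finD by (simp add: sh)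
  qed (simp add: Theta_eq)
  finally show ?thesis by simp
qed

text \<open>The sets \<open>Z(x(0, nJ))\<close> form a neighbourhood base at \<open>x\<close>.  They decrease with \<open>n\<close>, which settles
  finite intersections, and \<open>nJ\<close> eventually exceeds the degree of any given \<open>l\<close>, which settles the
  generators \<open>Z(l)\<close>.\<close>

lemma open_contains_J_cylinder:
  assumes J: "\<forall>i. J $ i > 0"
    and "openin (path_topology G) U" "x \<in> U"
  shows "x \<in> inf_paths G \<and> (\<exists>n. cylinder G (x (0, n *s J)) \<subseteq> U)"
proof -
  have "generate_topology_on (cylinder G ` mor G) U"
    using assms(2) by (simp add: path_topology_def openin_topology_generated_by_iff)
  then show ?thesis using assms(3)
  proof (induction arbitrary: x rule: generate_topology_on.induct)
    case (Int U V)
    then obtain m n where mn: "cylinder G (x (0, m *s J)) \<subseteq> U" "cylinder G (x (0, n *s J)) \<subseteq> V"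
      and x: "x \<in> inf_paths G" by blast
    have "cylinder G (x (0, max m n *s J)) \<subseteq> cylinder G (x (0, i *s J))" if "i \<le> max m n" for i
      by (rule initial_cylinders_antimono[OF x vec_nat_smult_mono[OF that]])
    then have "cylinder G (x (0, max m n *s J)) \<subseteq> U \<inter> V" using mn by (meson Int_greatest max.cobounded1 max.cobounded2 order_trans)
    with x show ?case by blast
  next
    case (UN K)
    then show ?case by blast
  next
    case (Basis s)
    then obtain l where l: "l \<in> mor G" "s = cylinder G l" by auto
    with Basis have x: "x \<in> inf_paths G" "x \<in> cylinder G l" by (auto simp: cylinder_def)
    let ?y = "x (0, (\<Sum>i\<in>UNIV. dg G l $ i) *s J)"
    have "cylinder G ?y \<subseteq> s"
      using initial_cylinders_antimono[OF x(1) vec_nat_le_smult[OF J, of "dg G l"]] l x(2)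
      by (simp add: cylinder_def[of G l])
    with x show ?case by blast
  qed simp
qed

text \<open>Every open set is the union of the cylinder sets of degree in \<open>\<nat>J\<close> that it contains, a countable
  union because there are only countably many morphisms.\<close>

lemma sigma_sets_J_cylinders:
  assumes J: "\<forall>i. J $ i > 0"
  shows "sigma_sets (inf_paths G) {U. openin (path_topology G) U} =
    sigma_sets (inf_paths G) {cylinder G l | l. l \<in> mor G \<and> (\<exists>n. dg G l = n *s J)}"
    (is "_ = sigma_sets _ ?C")
proof (rule sigma_sets_eqI)
  fix U assume "U \<in> {U. openin (path_topology G) U}"
  then have U: "openin (path_topology G) U" by simp
  let ?L = "{l \<in> mor G. (\<exists>n. dg G l = n *s J) \<and> cylinder G l \<subseteq> U}"
  have "U \<subseteq> (\<Union>l\<in>?L. cylinder G l)"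
  proof
    fix x assume "x \<in> U"
    from open_contains_J_cylinder[OF J U this] obtain n
      where n: "x \<in> inf_paths G" "cylinder G (x (0, n *s J)) \<subseteq> U" by blast
    with path_in_cylinder[OF n(1), of "n *s J"] show "x \<in> (\<Union>l\<in>?L. cylinder G l)" by blast
  qed
  then have eq: "U = (\<Union>l\<in>?L. cylinder G l)" by blast
  have "countable ?L" using countable_mor by (rule countable_subset[rotated]) blast
  then have "(\<Union>l\<in>?L. cylinder G l) \<in> sigma_sets (inf_paths G) ?C"
    by (intro sigma_sets_UNION) (auto intro!: sigma_sets.Basic)
  then show "U \<in> sigma_sets (inf_paths G) ?C" by (simp only: eq[symmetric])
next
  fix A assume "A \<in> ?C"
  then show "A \<in> sigma_sets (inf_paths G) {U. openin (path_topology G) U}"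
    by (auto intro!: sigma_sets.Basic topology_generated_by_Basis simp: path_topology_def)
qed

text \<open>The multiples of \<open>J\<close> are totally ordered, so any two of these cylinder sets are nested or disjoint.
  Cylinder sets of incomparable degrees may overlap without being nested.\<close>

lemma Int_stable_J_cylinders:
  "Int_stable (insert {} {cylinder G l | l. l \<in> mor G \<and> (\<exists>n. dg G l = n *s J)})" (is "Int_stable (insert _ ?C)")
proof (rule Int_stableI)
  fix A B assume AB: "A \<in> insert {} ?C" "B \<in> insert {} ?C"
  show "A \<inter> B \<in> insert {} ?C"
  proof (cases "A = {} \<or> B = {}")
    case False
    with AB obtain \<alpha> \<beta> m n where ab: "A = cylinder G \<alpha>" "B = cylinder G \<beta>" "\<alpha> \<in> mor G" "\<beta> \<in> mor G"
      "dg G \<alpha> = m *s J" "dg G \<beta> = n *s J" by blast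
    have "A \<subseteq> B \<or> B \<subseteq> A \<or> A \<inter> B = {}"
      using cylinder_nested[of \<alpha> \<beta>] cylinder_nested[of \<beta> \<alpha>] ab vec_nat_smult_mono[of m n J]
        vec_nat_smult_mono[of n m J] linear[of m n] by auto
    then have "A \<inter> B = A \<or> A \<inter> B = B \<or> A \<inter> B = {}" by blast
    then show ?thesis using AB by (elim disjE) simp_all
  qed auto
qed

end

section \<open>The Perron-Frobenius measure\<close>

lemma real_deg_add: "real_deg (m + n) = real_deg m + real_deg n"
  by (simp add: real_deg_def Finite_Cartesian_Product.vec_eq_iff)

lemma real_deg_zero: "real_deg 0 = 0"
  by (simp add: real_deg_def Finite_Cartesian_Product.vec_eq_iff)

lemma rho_pow_add: "rho_pow G (a + b) = rho_pow G a * rho_pow G b"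
  by (simp add: rho_pow_def powr_add prod.distrib)

locale pf_k_graph = k_graph G for G :: "('a, 'k::finite) graph_data" +
  fixes xv :: "'a \<Rightarrow> real" and M :: "('a, 'k) path measure"
  assumes fin_graph: "finite_graph G" and no_src: "no_sources G"
    and eigenvector: "pf_eigenvector G xv" and measure: "pf_measure G xv M"
begin

lemma finite_measure_M: "finite_measure M"
  using measure prob_space.finite_measure by (auto simp: pf_measure_def)

lemma finite_mor_deg: "finite (mor_deg G n)"
  using fin_graph by (simp add: finite_graph_def)

lemma finite_verts: "finite (verts G)"
  by (simp add: verts_def finite_mor_deg)

lemma finite_Dset: "finite (Dset G n v)"
  by (rule finite_subset[OF _ finite_mor_deg[of n]]) (auto simp: Dset_def mor_deg_def)

lemma finite_Cset: "finite (Cset G J j v)"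
  by (rule finite_subset[OF _ finite_mor_deg[of "j *s J"]]) (auto simp: Cset_def mor_deg_def)

lemma xv_pos: "v \<in> verts G \<Longrightarrow> xv v > 0"
  using eigenvector by (simp add: pf_eigenvector_def)

text \<open>The row of \<open>A\<^sub>i\<close> at any vertex \<open>v\<close> has a positive entry, as \<open>v\<close> is not a source.  The
  eigenvector equation at \<open>v\<close> then exhibits \<open>\<rho>(A\<^sub>i) x\<^sub>v\<close> as positive.\<close>

lemma rho_pos: "rho G i > 0"
proof -
  have "verts G \<noteq> {}" using eigenvector by (auto simp: pf_eigenvector_def)
  then obtain v where v: "v \<in> verts G" by blast
  then obtain l where l: "l \<in> mor_deg G (axis i 1)" "rng G l = v"
    using no_src by (auto simp: no_sources_def)
  then have w: "src G l \<in> verts G" by (auto simp: mor_deg_def src_verts)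
  have "{l' \<in> mor_deg G (axis i 1). rng G l' = v \<and> src G l' = src G l} \<noteq> {}" using l by blast
  then have "vertex_matrix G i v (src G l) > 0"
    by (simp add: vertex_matrix_def card_gt_0_iff finite_mor_deg)
  then have "0 < (\<Sum>w\<in>verts G. real (vertex_matrix G i v w) * xv w)"
    using w xv_pos by (intro sum_pos2[OF finite_verts w]) (auto intro!: mult_nonneg_nonneg less_imp_le[OF xv_pos])
  also have "\<dots> = rho G i * xv v" using eigenvector v by (simp add: pf_eigenvector_def)
  finally show ?thesis using xv_pos[OF v] by (simp add: zero_less_mult_iff)
qed

lemma rho_pow_pos: "rho_pow G a > 0"
  using rho_pos less_imp_neq[OF rho_pos] by (auto simp: rho_pow_def intro!: prod_pos)

lemma rho_pow_zero: "rho_pow G 0 = 1"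
  using rho_pos by (simp add: rho_pow_def less_imp_neq[symmetric])

lemma space_M: "space M = inf_paths G"
  using measure by (simp add: pf_measure_def)

lemma cylinder_sets: "l \<in> mor G \<Longrightarrow> cylinder G l \<in> sets M"
  using measure
  by (auto simp: pf_measure_def path_topology_def intro!: sigma_sets.Basic topology_generated_by_Basis)

definition cyl_mass :: "'a \<Rightarrow> real" where
  "cyl_mass l = rho_pow G (- real_deg (dg G l)) * xv (src G l)"

lemma measure_cylinder: "l \<in> mor G \<Longrightarrow> Sigma_Algebra.measure M (cylinder G l) = cyl_mass l"
  using measure by (simp add: pf_measure_def cyl_mass_def)

lemma cyl_mass_pos: "l \<in> mor G \<Longrightarrow> cyl_mass l > 0"
  by (simp add: cyl_mass_def rho_pow_pos xv_pos src_verts)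

text \<open>Self-similarity of the measure: the parts \<open>Z(\<alpha>\<beta>)\<close> of \<open>Z(\<alpha>)\<close> have the same proportions as the
  sets \<open>Z(\<beta>)\<close>, up to the common factor \<open>\<rho>(\<Lambda>)\<^bsup>-d(\<alpha>)\<^esup>\<close>.\<close>

lemma cyl_mass_cmp:
  assumes "\<alpha> \<in> mor G" "\<beta> \<in> mor G" "src G \<alpha> = rng G \<beta>"
  shows "cyl_mass (cmp G \<alpha> \<beta>) = rho_pow G (- real_deg (dg G \<alpha>)) * cyl_mass \<beta>"
  using assms by (simp add: cyl_mass_def dg_cmp src_cmp real_deg_add flip: rho_pow_add)

lemma coeff_inner_cyl_mass: "coeff_inner G xv J v a b = (\<Sum>\<mu>\<in>Dset G J v. cnj (a \<mu>) * b \<mu> * of_real (cyl_mass \<mu>))"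
  by (simp add: coeff_inner_def cyl_mass_def Dset_def)

lemma Theta_L2: "l \<in> mor G \<Longrightarrow> Theta G l \<in> L2 M"
  unfolding Theta_def by (intro finite_measure.indicator_L2[OF finite_measure_M] cylinder_sets)

lemma integral_Theta:
  assumes "l \<in> mor G"
  shows "(LINT x|M. Theta G l x) = of_real (cyl_mass l)"
proof -
  have "Theta G l x = complex_of_real (indicator (cylinder G l) x)" for x
    by (simp add: Theta_def indicator_def)
  then show ?thesis
    using sets.sets_into_space[OF cylinder_sets[OF assms]] measure_cylinder[OF assms]
    by (simp add: Int_absorb2)
qed

lemma L2_inner_Theta:
  assumes "\<alpha> \<in> mor G" "\<beta> \<in> mor G" "dg G \<alpha> = dg G \<beta>"
  shows "L2_inner M (Theta G \<alpha>) (Theta G \<beta>) = (if \<alpha> = \<beta> then of_real (cyl_mass \<alpha>) else 0)"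
proof -
  have "Theta G \<alpha> x * cnj (Theta G \<beta> x) = (if \<alpha> = \<beta> then Theta G \<alpha> x else 0)" for x
    using assms(3) by (auto simp: Theta_eq cylinder_def)
  then show ?thesis by (simp add: L2_inner_def integral_Theta assms(1,2))
qed

text \<open>The function on \<open>Z(l)\<close> with constant value \<open>a \<mu>\<close> on each part \<open>Z(l\<mu>)\<close>, \<open>d(\<mu>) = n\<close>.  For a vertex
  \<open>l = v\<close> and \<open>a = c\<^bsup>m,v\<^esup>\<close> it is \<open>f\<^bsup>m,v\<^esup>\<close>; in general it is a multiple of \<open>S\<^sub>l f\<^bsup>m,v\<^esup>\<close> with \<open>v = s(l)\<close>.\<close>

definition step_function :: "nat ^ 'k \<Rightarrow> 'a \<Rightarrow> ('a \<Rightarrow> complex) \<Rightarrow> ('a, 'k) path \<Rightarrow> complex" where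
  "step_function n l a x = (\<Sum>\<mu>\<in>Dset G n (src G l). a \<mu> * Theta G (cmp G l \<mu>) x)"

lemma DsetD:
  assumes "\<mu> \<in> Dset G n v"
  shows "\<mu> \<in> mor G" "dg G \<mu> = n" "rng G \<mu> = v"
  using assms by (auto simp: Dset_def)

lemma cmp_Dset:
  assumes "l \<in> mor G" "\<mu> \<in> Dset G n (src G l)"
  shows "cmp G l \<mu> \<in> mor G" "dg G (cmp G l \<mu>) = dg G l + n"
    "cyl_mass (cmp G l \<mu>) = rho_pow G (- real_deg (dg G l)) * cyl_mass \<mu>"
  using DsetD[OF assms(2)] assms(1) by (simp_all add: cmp_mor dg_cmp cyl_mass_cmp)

lemma step_function_L2: "l \<in> mor G \<Longrightarrow> step_function n l a \<in> L2 M"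
  unfolding step_function_def by (intro L2_sum L2_scale Theta_L2 cmp_Dset)

lemma L2_inner_step_function_left:
  assumes "l \<in> mor G" "g \<in> L2 M"
  shows "L2_inner M (step_function n l a) g =
    (\<Sum>\<mu>\<in>Dset G n (src G l). a \<mu> * L2_inner M (Theta G (cmp G l \<mu>)) g)"
  unfolding step_function_def using assms
  by (subst L2_inner_sum_left) (auto simp: L2_inner_scale_left intro!: L2_scale Theta_L2 cmp_Dset)

lemma L2_inner_step_function_right:
  assumes "l \<in> mor G" "g \<in> L2 M"
  shows "L2_inner M g (step_function n l a) =
    (\<Sum>\<mu>\<in>Dset G n (src G l). cnj (a \<mu>) * L2_inner M g (Theta G (cmp G l \<mu>)))"
  by (subst (1 2) L2_inner_commute) (simp add: L2_inner_step_function_left[OF assms])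

text \<open>By self-similarity, \<open>a \<mapsto> step_function n l a\<close> is, up to a scalar, an isometry from the
  coefficient vectors with their weighted inner product.  For different \<open>l\<close> of the same degree the
  supports are disjoint.  The arguments \<open>a\<close> and \<open>b\<close> change places because \<open>coeff_inner\<close> is
  antilinear in its first argument and \<open>L2_inner\<close> in its second.\<close>

lemma L2_inner_step_function:
  assumes l: "l \<in> mor G" and l': "l' \<in> mor G" and deg: "dg G l = dg G l'"
  shows "L2_inner M (step_function n l a) (step_function n l' b) =
    (if l = l' then of_real (rho_pow G (- real_deg (dg G l))) * coeff_inner G xv n (src G l) b a else 0)"
proof -
  let ?r = "complex_of_real (rho_pow G (- real_deg (dg G l)))"
  have inner: "L2_inner M (Theta G (cmp G l \<mu>)) (Theta G (cmp G l' \<mu>')) =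
      (if l = l' \<and> \<mu> = \<mu>' then ?r * of_real (cyl_mass \<mu>) else 0)"
    if mu: "\<mu> \<in> Dset G n (src G l)" "\<mu>' \<in> Dset G n (src G l')" for \<mu> \<mu>'
  proof -
    have "cmp G l \<mu> = cmp G l' \<mu>' \<longleftrightarrow> l = l' \<and> \<mu> = \<mu>'"
      using factor_unique[OF l DsetD(1)[OF mu(1)] _ l' DsetD(1)[OF mu(2)] _ deg]
        DsetD(3)[OF mu(1)] DsetD(3)[OF mu(2)] by metis
    then show ?thesis
      using L2_inner_Theta[OF cmp_Dset(1)[OF l mu(1)] cmp_Dset(1)[OF l' mu(2)]]
        cmp_Dset(2,3)[OF l mu(1)] cmp_Dset(2,3)[OF l' mu(2)] deg by simp
  qed
  have "L2_inner M (step_function n l a) (step_function n l' b) = (\<Sum>\<mu>\<in>Dset G n (src G l). a \<mu> *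
      (\<Sum>\<mu>'\<in>Dset G n (src G l'). cnj (b \<mu>') * (if l = l' \<and> \<mu> = \<mu>' then ?r * of_real (cyl_mass \<mu>) else 0)))"
    using L2_inner_step_function_left[OF l step_function_L2[OF l']] L2_inner_step_function_right[OF l' Theta_L2[OF cmp_Dset(1)[OF l]]]
    by (simp add: inner cong: sum.cong)
  also have "\<dots> = (if l = l' then ?r * coeff_inner G xv n (src G l) b a else 0)"
  proof (cases "l = l'")
    case True
    have "(\<Sum>\<mu>'\<in>Dset G n (src G l'). cnj (b \<mu>') * (if l = l' \<and> \<mu> = \<mu>' then ?r * of_real (cyl_mass \<mu>) else 0))
        = cnj (b \<mu>) * (?r * of_real (cyl_mass \<mu>))" if "\<mu> \<in> Dset G n (src G l)" for \<mu>
      using that True finite_Dset by (simp add: if_distrib[of "\<lambda>y. _ * y"] cong: if_cong)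
    then show ?thesis using True
      by (simp add: coeff_inner_cyl_mass sum_distrib_left mult_ac cong: sum.cong)
  qed simp
  finally show ?thesis .
qed

text \<open>On \<open>Z(l)\<close> the function \<open>\<Theta>\<^sub>\<beta>\<close> is constant, and a coefficient vector orthogonal to \<open>(1, \<dots>, 1)\<close>
  gives a step function with integral zero.\<close>

lemma L2_inner_step_function_coarse:
  assumes l: "l \<in> mor G" and b: "\<beta> \<in> mor G" and le: "dg G \<beta> \<le> dg G l"
    and mean_zero: "coeff_inner G xv n (src G l) (\<lambda>_. 1) a = 0"
  shows "L2_inner M (step_function n l a) (Theta G \<beta>) = 0"
proof -
  have inner: "L2_inner M (step_function n l a) (Theta G \<beta>) =
      (\<Sum>\<mu>\<in>Dset G n (src G l). a \<mu> * L2_inner M (Theta G (cmp G l \<mu>)) (Theta G \<beta>))"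
    by (rule L2_inner_step_function_left[OF l Theta_L2[OF b]])
  have sub: "cylinder G (cmp G l \<mu>) \<subseteq> cylinder G l" if "\<mu> \<in> Dset G n (src G l)" for \<mu>
    using cylinder_cmp[OF l DsetD(1)[OF that]] DsetD(3)[OF that] by auto
  from cylinder_nested[OF l b le] show ?thesis
  proof
    assume "cylinder G l \<subseteq> cylinder G \<beta>"
    then have absorb: "Theta G (cmp G l \<mu>) x * cnj (Theta G \<beta> x) = Theta G (cmp G l \<mu>) x"
      if "\<mu> \<in> Dset G n (src G l)" for \<mu> x
      using sub[OF that] by (auto simp: Theta_eq)
    then have "L2_inner M (Theta G (cmp G l \<mu>)) (Theta G \<beta>) =
        of_real (rho_pow G (- real_deg (dg G l))) * of_real (cyl_mass \<mu>)"
      if "\<mu> \<in> Dset G n (src G l)" for \<mu>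
      by (simp only: L2_inner_def absorb[OF that] integral_Theta cmp_Dset[OF l that] of_real_mult)
    then have "L2_inner M (step_function n l a) (Theta G \<beta>) =
        of_real (rho_pow G (- real_deg (dg G l))) * coeff_inner G xv n (src G l) (\<lambda>_. 1) a"
      by (simp add: inner coeff_inner_cyl_mass sum_distrib_left mult_ac cong: sum.cong)
    then show ?thesis by (simp add: mean_zero)
  next
    assume "cylinder G l \<inter> cylinder G \<beta> = {}"
    then have annihilate: "Theta G (cmp G l \<mu>) x * cnj (Theta G \<beta> x) = 0"
      if "\<mu> \<in> Dset G n (src G l)" for \<mu> x
      using sub[OF that] by (auto simp: Theta_eq)
    have "L2_inner M (Theta G (cmp G l \<mu>)) (Theta G \<beta>) = 0" if "\<mu> \<in> Dset G n (src G l)" for \<mu>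
      by (simp only: L2_inner_def annihilate[OF that] integral_zero)
    then show ?thesis by (simp add: inner)
  qed
qed

lemma Sop_wavelet_f:
  assumes "l \<in> mor G"
  shows "Sop G l (wavelet_f G J c m (src G l)) =
    (\<lambda>x. of_real (rho_pow G ((1 / 2) *\<^sub>R real_deg (dg G l))) * step_function J l (c (src G l) m) x)"
proof
  fix x
  have "Theta G l x * wavelet_f G J c m (src G l) (shift (dg G l) x) = step_function J l (c (src G l) m) x"
    unfolding wavelet_f_def step_function_def sum_distrib_left
    by (intro sum.cong refl) (simp add: Theta_cmp[OF assms] DsetD)
  then show "Sop G l (wavelet_f G J c m (src G l)) x =
      of_real (rho_pow G ((1 / 2) *\<^sub>R real_deg (dg G l))) * step_function J l (c (src G l) m) x"
    by (simp add: Sop_def mult_ac)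
qed

text \<open>The \<open>\<pi>\<close>-system is formed by the cylinder sets of degree in \<open>\<nat>J\<close> and the empty set, and the
  constant \<open>1\<close> is the sum of the \<open>\<Theta>\<^sub>v\<close> over the vertices \<open>v\<close>, which have degree \<open>0 J\<close>.\<close>

lemma L2_eq_closed_span_SJ:
  assumes J: "\<forall>i. J $ i > 0"
  shows "L2 M = closed_span M (SJ G J)"
proof -
  let ?C = "{cylinder G l | l. l \<in> mor G \<and> (\<exists>n. dg G l = n *s J)}"
  have SJ_L2: "SJ G J \<subseteq> L2 M" by (auto simp: SJ_def Theta_L2)
  have sets: "?C \<subseteq> sets M" by (auto simp: cylinder_sets)
  have "sigma_sets (space M) ?C \<subseteq> sigma_sets (space M) (insert {} ?C)"
    by (rule sigma_sets_mono') blast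
  moreover have "sigma_sets (space M) (insert {} ?C) \<subseteq> sets M"
    using sets by (intro sets.sigma_sets_subset) auto
  moreover have "sets M = sigma_sets (space M) ?C"
    using measure sigma_sets_J_cylinders[OF J] by (simp add: pf_measure_def)
  ultimately have gen: "sets M = sigma_sets (space M) (insert {} ?C)" by simp
  show ?thesis
  proof (rule finite_measure.closed_span_indicators_eq_L2[OF finite_measure_M Int_stable_J_cylinders[of J] _ gen])
    show "insert {} ?C \<subseteq> sets M" using sets by auto
  next
    fix A assume "A \<in> insert {} ?C"
    then consider "A = {}" | l where "A = cylinder G l" "Theta G l \<in> SJ G J"
      by (auto simp: SJ_def)
    then show "indicator A \<in> closed_span M (SJ G J)"
    proof cases
      case 1
      show ?thesis unfolding 1
        using closed_span_zero[of M "SJ G J"] by (rule closed_span_cong_space) simp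
    next
      case 2
      then show ?thesis
        using closed_span_lin_span[OF lin_span_base[OF 2(2)] SJ_L2] by (simp add: Theta_def)
    qed
  next
    have "(\<lambda>x. \<Sum>v\<in>verts G. Theta G v x) \<in> closed_span M (SJ G J)"
    proof (intro closed_span_sum closed_span_lin_span[OF lin_span_base SJ_L2])
      fix v assume "v \<in> verts G"
      from vertD[OF this] show "Theta G v \<in> SJ G J"
        unfolding SJ_def by (auto intro!: exI[of _ v] exI[of _ 0] simp: vec_nat_smult_zero)
    qed
    then show "indicator (space M) \<in> closed_span M (SJ G J)"
    proof (rule closed_span_cong_space)
      fix x assume x: "x \<in> space M"
      then have xp: "x \<in> inf_paths G" by (simp add: space_M)
      have "Theta G v x = (if v = x (0, 0) then 1 else 0)" if "v \<in> verts G" for v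
        using vertD[OF that] xp by (auto simp: Theta_eq cylinder_def)
      moreover have "x (0, 0) \<in> verts G"
        using path_in_cylinder[OF xp, of 0] by (simp add: verts_def mor_deg_def)
      ultimately show "indicator (space M) x = (\<Sum>v\<in>verts G. Theta G v x)"
        using x finite_verts by (simp cong: sum.cong)
    qed
  qed
qed

end

section \<open>The wavelet decomposition\<close>

locale pf_wavelets = pf_k_graph G xv M
  for G :: "('a, 'k::finite) graph_data" and xv :: "'a \<Rightarrow> real" and M :: "('a, 'k) path measure" +
  fixes J :: "nat ^ 'k" and c :: "'a \<Rightarrow> nat \<Rightarrow> 'a \<Rightarrow> complex"
  assumes J_pos: "\<forall>i. J $ i > 0"
    and coeffs: "\<forall>v \<in> verts G. wavelet_coeffs G xv J v (c v)"
begin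

definition wavelet_index :: "nat \<Rightarrow> ('a \<times> 'a \<times> nat) set" where
  "wavelet_index j = {(v, l, m). v \<in> verts G \<and> l \<in> Cset G J j v \<and> m \<in> {1..card (Dset G J v) - 1}}"

definition wavelet :: "'a \<times> 'a \<times> nat \<Rightarrow> ('a, 'k) path \<Rightarrow> complex" where
  "wavelet = (\<lambda>(v, l, m). Sop G l (wavelet_f G J c m v))"

lemma CsetD:
  assumes "l \<in> Cset G J j v"
  shows "l \<in> mor G" "src G l = v" "dg G l = j *s J"
  using assms by (auto simp: Cset_def)

lemma wavelet_index_iff:
  "(v, l, m) \<in> wavelet_index j \<longleftrightarrow> v \<in> verts G \<and> l \<in> Cset G J j v \<and> m \<in> {1..card (Dset G J v) - 1}"
  by (simp add: wavelet_index_def)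

lemma finite_wavelet_index: "finite (wavelet_index j)"
proof -
  have "wavelet_index j = (SIGMA v:verts G. Cset G J j v \<times> {1..card (Dset G J v) - 1})"
    by (auto simp: wavelet_index_def)
  then show ?thesis by (simp add: finite_verts finite_Cset)
qed

lemma wavelet_eq:
  assumes "(v, l, m) \<in> wavelet_index j"
  shows "wavelet (v, l, m) =
    (\<lambda>x. of_real (rho_pow G ((1 / 2) *\<^sub>R real_deg (j *s J))) * step_function J l (c v m) x)"
  using assms Sop_wavelet_f[of l J c m] CsetD[of l j v] by (auto simp: wavelet_def wavelet_index_iff)

lemma wavelet_L2: "i \<in> wavelet_index j \<Longrightarrow> wavelet i \<in> L2 M"
  by (cases i) (auto simp: wavelet_eq wavelet_index_iff intro!: L2_scale step_function_L2 CsetD(1))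

text \<open>The factor \<open>\<rho>(\<Lambda>)\<^bsup>d(l)/2\<^esup>\<close> in \<open>S\<^sub>l\<close> occurs twice in the inner product and cancels the scalar
  \<open>\<rho>(\<Lambda>)\<^bsup>-d(l)\<^esup>\<close> of the isometry, so orthonormality of the \<open>c\<^bsup>m,v\<^esup>\<close> carries over.  The level
  \<open>j = 0\<close> is included and consists of the functions \<open>f\<^bsup>m,v\<^esup>\<close> themselves.\<close>

lemma wavelets_orthonormal: "orthonormal_family M (wavelet_index j) wavelet"
  unfolding orthonormal_family_def
proof (intro conjI ballI wavelet_L2)
  fix p q assume p: "p \<in> wavelet_index j" and q: "q \<in> wavelet_index j"
  obtain v l m where p': "p = (v, l, m)" by (cases p)
  obtain v' l' m' where q': "q = (v', l', m')" by (cases q)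
  let ?h = "rho_pow G ((1 / 2) *\<^sub>R real_deg (j *s J))"
  have l: "l \<in> mor G" "src G l = v" "dg G l = j *s J" and v: "v \<in> verts G"
    and m: "m \<in> {1..card (Dset G J v) - 1}"
    using p CsetD[of l j v] by (auto simp: p' wavelet_index_iff)
  have l': "l' \<in> mor G" "src G l' = v'" "dg G l' = j *s J"
    and m': "m' \<in> {1..card (Dset G J v') - 1}"
    using q CsetD[of l' j v'] by (auto simp: q' wavelet_index_iff)
  have norm: "?h * ?h * rho_pow G (- real_deg (j *s J)) = 1"
    by (simp add: rho_pow_zero flip: rho_pow_add scaleR_add_left)
  have "L2_inner M (wavelet p) (wavelet q) =
      of_real (?h * ?h) * L2_inner M (step_function J l (c v m)) (step_function J l' (c v' m'))"
    using p q by (simp add: p' q' wavelet_eq L2_inner_scale_left L2_inner_scale_right)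
  also have "\<dots> = (if l = l' then of_real (?h * ?h * rho_pow G (- real_deg (j *s J))) *
      coeff_inner G xv J v (c v' m') (c v m) else 0)"
    using l l' by (auto simp: L2_inner_step_function)
  also have "\<dots> = (if p = q then 1 else 0)"
    unfolding norm using coeffs v m m' l l' by (auto simp: p' q' wavelet_coeffs_def)
  finally show "L2_inner M (wavelet p) (wavelet q) = (if p = q then 1 else 0)" .
qed

lemma wavelet_orthogonal_coarse:
  assumes p: "p \<in> wavelet_index j" and b: "\<beta> \<in> mor G" "dg G \<beta> \<le> j *s J"
  shows "L2_inner M (wavelet p) (Theta G \<beta>) = 0"
proof -
  obtain v l m where p': "p = (v, l, m)" by (cases p)
  have l: "l \<in> mor G" "src G l = v" "dg G l = j *s J" and "v \<in> verts G"
    and "m \<in> {1..card (Dset G J v) - 1}"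
    using p CsetD[of l j v] by (auto simp: p' wavelet_index_iff)
  then have "coeff_inner G xv J (src G l) (\<lambda>_. 1) (c v m) = 0"
    using coeffs by (simp add: wavelet_coeffs_def)
  from L2_inner_step_function_coarse[OF l(1) b(1) _ this] show ?thesis
    using p l b by (simp add: p' wavelet_eq L2_inner_scale_left)
qed

text \<open>A wavelet of level \<open>i\<close> is a combination of functions \<open>\<Theta>\<^sub>\<beta>\<close> with \<open>d(\<beta>) = (i + 1)J \<le> jJ\<close>, and
  wavelets of level \<open>j\<close> are orthogonal to those.\<close>

lemma wavelet_levels_orthogonal:
  assumes ij: "i < j" and p: "p \<in> wavelet_index j" and q: "q \<in> wavelet_index i"
  shows "L2_inner M (wavelet p) (wavelet q) = 0"
proof -
  obtain v l m where q': "q = (v, l, m)" by (cases q)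
  have l: "l \<in> mor G" "src G l = v" "dg G l = i *s J"
    using q CsetD[of l i v] by (auto simp: q' wavelet_index_iff)
  have "L2_inner M (wavelet p) (Theta G (cmp G l \<mu>)) = 0" if "\<mu> \<in> Dset G J (src G l)" for \<mu>
    using cmp_Dset[OF l(1) that] vec_nat_smult_mono[of "Suc i" j J] ij l(3)
    by (intro wavelet_orthogonal_coarse[OF p]) (simp_all add: vec_nat_smult_Suc)
  then have "L2_inner M (wavelet p) (step_function J l (c v m)) = 0"
    by (simp add: L2_inner_step_function_right[OF l(1) wavelet_L2[OF p]])
  then show ?thesis using q by (simp add: q' wavelet_eq L2_inner_scale_right)
qed

text \<open>The index is shifted by one to make room for the scaling functions \<open>\<Theta>\<^sub>v\<close> at \<open>0\<close>.\<close>

definition level_basis :: "nat \<Rightarrow> (('a, 'k) path \<Rightarrow> complex) set" where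
  "level_basis n = (case n of 0 \<Rightarrow> Theta G ` verts G | Suc j \<Rightarrow> wavelet ` wavelet_index j)"

text \<open>The all-ones vector and the \<open>c\<^bsup>m,v\<^esup>\<close> span all coefficient vectors.  Writing the unit vector at \<open>\<mu>\<close>
  in terms of them and passing to step functions on \<open>Z(\<alpha>)\<close> expresses \<open>\<Theta>\<^sub>\<alpha>\<^sub>\<mu>\<close>: the all-ones vector
  becomes \<open>\<Theta>\<^sub>\<alpha>\<close>, and \<open>c\<^bsup>m,v\<^esup>\<close> becomes a multiple of a wavelet of level \<open>n\<close>.\<close>

lemma Theta_refined_in_span:
  assumes a: "\<alpha> \<in> mor G" "dg G \<alpha> = n *s J" and mu: "\<mu> \<in> Dset G J (src G \<alpha>)"
  shows "Theta G (cmp G \<alpha> \<mu>) \<in> lin_span (insert (Theta G \<alpha>) (wavelet ` wavelet_index n))"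
proof -
  let ?D = "Dset G J (src G \<alpha>)" and ?I = "{1..card (Dset G J (src G \<alpha>)) - 1}"
  let ?h = "rho_pow G ((1 / 2) *\<^sub>R real_deg (n *s J))"
  have v: "src G \<alpha> \<in> verts G" by (rule src_verts[OF a(1)])
  \<comment> \<open>Split the unit vector at \<open>\<mu>\<close> into its mean and a vector orthogonal to \<open>(1, \<dots>, 1)\<close>.\<close>
  define s where "s = cyl_mass \<mu> / (\<Sum>\<nu>\<in>?D. cyl_mass \<nu>)"
  define b where "b = (\<lambda>\<nu>. (if \<nu> = \<mu> then 1 else 0) - complex_of_real s)"
  have "(\<Sum>\<nu>\<in>?D. cyl_mass \<nu>) > 0"
    using mu finite_Dset by (intro sum_pos cyl_mass_pos DsetD(1)) auto
  then have s: "s * (\<Sum>\<nu>\<in>?D. cyl_mass \<nu>) = cyl_mass \<mu>" by (simp add: s_def)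
  have "coeff_inner G xv J (src G \<alpha>) (\<lambda>_. 1) b =
      (\<Sum>\<nu>\<in>?D. (if \<nu> = \<mu> then of_real (cyl_mass \<mu>) else 0) - of_real (s * cyl_mass \<nu>))"
    unfolding coeff_inner_cyl_mass by (intro sum.cong) (auto simp: b_def left_diff_distrib)
  also have "\<dots> = of_real (cyl_mass \<mu>) - of_real (s * (\<Sum>\<nu>\<in>?D. cyl_mass \<nu>))"
    using mu finite_Dset by (simp add: sum_subtractf sum_distrib_left)
  finally have "coeff_inner G xv J (src G \<alpha>) (\<lambda>_. 1) b = 0" by (simp add: s)
  then obtain t where t: "\<And>\<nu>. \<nu> \<in> ?D \<Longrightarrow> b \<nu> = (\<Sum>m\<in>?I. t m * c (src G \<alpha>) m \<nu>)"
    using coeffs v unfolding wavelet_coeffs_def by blast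
  have h: "?h \<noteq> 0" using rho_pow_pos by (simp add: less_imp_neq[symmetric])
  have wavelet_index: "(src G \<alpha>, \<alpha>, m) \<in> wavelet_index n" if "m \<in> ?I" for m
    using that a v by (simp add: wavelet_index_iff Cset_def)
  have "Theta G (cmp G \<alpha> \<mu>) = (\<lambda>x. of_real s * Theta G \<alpha> x +
      (\<Sum>m\<in>?I. (t m / of_real ?h) * wavelet (src G \<alpha>, \<alpha>, m) x))"
  proof
    fix x
    have "Theta G (cmp G \<alpha> \<mu>) x = (\<Sum>\<nu>\<in>?D. (if \<nu> = \<mu> then 1 else 0) * Theta G (cmp G \<alpha> \<nu>) x)"
      using mu finite_Dset by (simp add: if_distrib[of "\<lambda>y. y * _"] cong: if_cong)
    also have "\<dots> = (\<Sum>\<nu>\<in>?D. of_real s * Theta G (cmp G \<alpha> \<nu>) x + b \<nu> * Theta G (cmp G \<alpha> \<nu>) x)"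
      by (intro sum.cong refl) (simp add: b_def algebra_simps)
    also have "\<dots> = of_real s * Theta G \<alpha> x + (\<Sum>\<nu>\<in>?D. b \<nu> * Theta G (cmp G \<alpha> \<nu>) x)"
      by (simp add: sum.distrib Theta_refine[OF fin_graph a(1), of x J] sum_distrib_left)
    also have "(\<Sum>\<nu>\<in>?D. b \<nu> * Theta G (cmp G \<alpha> \<nu>) x) =
        (\<Sum>\<nu>\<in>?D. \<Sum>m\<in>?I. t m * (c (src G \<alpha>) m \<nu> * Theta G (cmp G \<alpha> \<nu>) x))"
      by (intro sum.cong refl) (simp add: t sum_distrib_right mult.assoc)
    also have "\<dots> = (\<Sum>m\<in>?I. t m * step_function J \<alpha> (c (src G \<alpha>) m) x)"
      by (subst sum.swap) (simp add: step_function_def sum_distrib_left)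
    also have "\<dots> = (\<Sum>m\<in>?I. (t m / of_real ?h) * wavelet (src G \<alpha>, \<alpha>, m) x)"
      using h by (intro sum.cong refl) (simp add: wavelet_eq[OF wavelet_index])
    finally show "Theta G (cmp G \<alpha> \<mu>) x = of_real s * Theta G \<alpha> x +
      (\<Sum>m\<in>?I. (t m / of_real ?h) * wavelet (src G \<alpha>, \<alpha>, m) x)" .
  qed
  also have "\<dots> \<in> lin_span (insert (Theta G \<alpha>) (wavelet ` wavelet_index n))"
    using wavelet_index by (intro lin_span_add lin_span_scale lin_span_sum lin_span_base) auto
  finally show ?thesis .
qed

lemma Theta_in_span_level_basis:
  assumes "l \<in> mor G" "dg G l = n *s J"
  shows "Theta G l \<in> lin_span (\<Union>n. level_basis n)"
  using assms
proof (induction n arbitrary: l)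
  case 0
  then have "l \<in> verts G" by (simp add: verts_def mor_deg_def vec_nat_smult_zero)
  then have "Theta G l \<in> level_basis 0" by (simp add: level_basis_def)
  then show ?case by (intro lin_span_base) blast
next
  case (Suc n)
  from Suc.prems(2) have "dg G l = n *s J + J" by (simp add: vec_nat_smult_Suc)
  from factor_obtain[OF Suc.prems(1) this] obtain \<alpha> \<mu> where
    am: "\<alpha> \<in> mor G" "\<mu> \<in> mor G" "src G \<alpha> = rng G \<mu>" "dg G \<alpha> = n *s J" "dg G \<mu> = J"
    and l: "cmp G \<alpha> \<mu> = l" by metis
  have "wavelet ` wavelet_index n = level_basis (Suc n)" by (simp add: level_basis_def)
  then have "wavelet ` wavelet_index n \<subseteq> lin_span (\<Union>n. level_basis n)" by (blast intro: lin_span_base)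
  with Suc.IH[OF am(1,4)]
  have "lin_span (insert (Theta G \<alpha>) (wavelet ` wavelet_index n)) \<subseteq> lin_span (\<Union>n. level_basis n)"
    by (intro lin_span_minimal) auto
  moreover have "Theta G l \<in> lin_span (insert (Theta G \<alpha>) (wavelet ` wavelet_index n))"
    using Theta_refined_in_span[OF am(1,4), of \<mu>] am by (simp add: Dset_def l)
  ultimately show ?case by blast
qed

lemma closed_span_SJ_eq_level_basis: "closed_span M (SJ G J) = closed_span M (\<Union>n. level_basis n)"
proof -
  have "SJ G J \<subseteq> lin_span (\<Union>n. level_basis n)"
    by (auto simp: SJ_def intro: Theta_in_span_level_basis)
  from closed_span_mono_lin_span[OF this, of M] show ?thesis
    using L2_eq_closed_span_SJ[OF J_pos] closed_span_L2[of M "\<Union>n. level_basis n"] by simp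
qed

lemma hilbert_sum_level_basis: "is_hilbert_sum M (closed_span M (\<Union>n. level_basis n)) (\<lambda>n. closed_span M (level_basis n))"
proof (rule is_hilbert_sum_orthogonal_bases)
  have vert_inner: "L2_inner M (Theta G v) (Theta G w) = (if v = w then of_real (cyl_mass v) else 0)"
    if "v \<in> verts G" "w \<in> verts G" for v w
    using vertD[OF that(1)] vertD[OF that(2)] by (simp add: L2_inner_Theta)
  have wav_inner: "L2_inner M (wavelet p) (wavelet q) = (if p = q then 1 else 0)"
    if "p \<in> wavelet_index j" "q \<in> wavelet_index j" for p q j
    using wavelets_orthonormal[of j] that by (simp add: orthonormal_family_def)
  show "finite (level_basis n)" for n
    by (auto simp: level_basis_def finite_verts finite_wavelet_index split: nat.split)
  show "level_basis n \<subseteq> L2 M" for n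
    by (auto simp: level_basis_def intro: Theta_L2 vertD wavelet_L2 split: nat.split)
  show "L2_inner M b b \<noteq> 0" if "b \<in> level_basis n" for n b
    using that cyl_mass_pos vertD(1)
    by (fastforce simp: level_basis_def vert_inner wav_inner split: nat.splits)
  show "L2_inner M b b' = 0" if "b \<in> level_basis n" "b' \<in> level_basis n" "b \<noteq> b'" for n b b'
    using that by (auto simp: level_basis_def vert_inner wav_inner split: nat.splits)
  show "L2_inner M b b' = 0" if mn: "m < n" and b: "b \<in> level_basis m" "b' \<in> level_basis n" for m n b b'
  proof -
    obtain j where n: "n = Suc j" using mn by (cases n) auto
    then obtain q where q: "q \<in> wavelet_index j" "b' = wavelet q" using b by (auto simp: level_basis_def)
    have "L2_inner M b' b = 0"
    proof (cases m)
      case 0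
      then obtain v where "v \<in> verts G" "b = Theta G v" using b by (auto simp: level_basis_def)
      then show ?thesis
        using wavelet_orthogonal_coarse[OF q(1)] vertD[of v] by (simp add: q(2) vec_nat_le_add)
    next
      case (Suc i)
      then obtain p where "p \<in> wavelet_index i" "b = wavelet p" using b by (auto simp: level_basis_def)
      then show ?thesis using Suc mn n q wavelet_levels_orthogonal[of i j q p] by simp
    qed
    then show ?thesis by (rule L2_inner_zero_commute)
  qed
qed

lemma Cset_zero:
  assumes v: "v \<in> verts G"
  shows "Cset G J 0 v = {v}"
proof -
  have "l = v" if l: "l \<in> Cset G J 0 v" for l
  proof -
    have "l \<in> verts G"
      using CsetD(1,3)[OF l] by (simp add: verts_def mor_deg_def vec_nat_smult_zero)
    from vertD(4)[OF this] CsetD(2)[OF l] show ?thesis by simp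
  qed
  moreover have "v \<in> Cset G J 0 v" using vertD[OF v] by (simp add: Cset_def vec_nat_smult_zero)
  ultimately show ?thesis by blast
qed

text \<open>This makes \<open>W\<^sub>0\<close> the case \<open>j = 0\<close> of the general level, in place of a separate definition.\<close>

lemma Sop_vertex_wavelet_f:
  assumes v: "v \<in> verts G"
  shows "Sop G v (wavelet_f G J c m v) = wavelet_f G J c m v"
proof
  fix x
  note vD = vertD[OF v]
  have "cmp G v \<mu> = \<mu>" if "\<mu> \<in> Dset G J v" for \<mu>
    using cmp_rng[OF DsetD(1)[OF that]] DsetD(3)[OF that] by simp
  then show "Sop G v (wavelet_f G J c m v) x = wavelet_f G J c m v x"
    using Sop_wavelet_f[OF vD(1), of J c m] vD
    by (simp add: real_deg_zero rho_pow_zero step_function_def wavelet_f_def cong: sum.cong)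
qed

lemma closed_span_level_basis: "closed_span M (level_basis n) = (case n of 0 \<Rightarrow> V0 G M | Suc j \<Rightarrow> W G M J c j)"
proof (cases n)
  case 0
  then show ?thesis by (simp add: level_basis_def V0_def)
next
  case (Suc j)
  have "wavelet ` wavelet_index j = {Sop G l (wavelet_f G J c m v) | v l m.
      v \<in> verts G \<and> l \<in> Cset G J j v \<and> m \<in> {1..card (Dset G J v) - 1}}"
    by (force simp: wavelet_def wavelet_index_def)
  moreover have "wavelet ` wavelet_index 0 = {wavelet_f G J c m v | v m.
      v \<in> verts G \<and> m \<in> {1..card (Dset G J v) - 1}}" (is "_ = ?F")
  proof (intro equalityI subsetI)
    fix f assume "f \<in> wavelet ` wavelet_index 0"
    then obtain v l m where "f = Sop G l (wavelet_f G J c m v)" "(v, l, m) \<in> wavelet_index 0"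
      by (auto simp: wavelet_def)
    then show "f \<in> ?F" using Cset_zero[of v] Sop_vertex_wavelet_f[of v m] by (auto simp: wavelet_index_iff)
  next
    fix f assume "f \<in> ?F"
    then obtain v m where f: "f = wavelet_f G J c m v" "v \<in> verts G" "m \<in> {1..card (Dset G J v) - 1}"
      by blast
    then have "(v, v, m) \<in> wavelet_index 0" by (simp add: wavelet_index_iff Cset_zero)
    moreover have "f = wavelet (v, v, m)" by (simp add: wavelet_def f Sop_vertex_wavelet_f)
    ultimately show "f \<in> wavelet ` wavelet_index 0" by blast
  qed
  ultimately show ?thesis by (cases "j = 0") (simp_all add: Suc level_basis_def W_def)
qed

end

theorem theorem5p2:
  fixes G :: "('a, 'k::finite) graph_data"
    and M :: "('a, 'k) path measure"
    and xv :: "'a \<Rightarrow> real"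
    and J :: "nat ^ 'k"
    and c :: "'a \<Rightarrow> nat \<Rightarrow> 'a \<Rightarrow> complex"
  assumes "k_graph G" and "finite_graph G" and "strongly_connected G" and "no_sources G"
    and "pf_eigenvector G xv" and "pf_measure G xv M"
    and "\<forall>i. J $ i > 0"
    and "\<forall>v \<in> verts G. wavelet_coeffs G xv J v (c v)"
  shows "(\<forall>j\<ge>1. orthonormal_family M
            {(v, l, m). v \<in> verts G \<and> l \<in> Cset G J j v \<and> m \<in> {1..card (Dset G J v) - 1}}
            (\<lambda>(v, l, m). Sop G l (wavelet_f G J c m v)))
    \<and> (\<forall>i j. \<forall>v \<in> verts G. \<forall>v' \<in> verts G. \<forall>l \<in> Cset G J j v. \<forall>\<mu> \<in> Cset G J i v'.
          \<forall>m \<in> {1..card (Dset G J v) - 1}. \<forall>m' \<in> {1..card (Dset G J v') - 1}.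
            0 < i \<and> i < j \<longrightarrow>
            (LINT x|M. Sop G l (wavelet_f G J c m v) x * cnj (Sop G \<mu> (wavelet_f G J c m' v') x)) = 0)
    \<and> L2 M = closed_span M (SJ G J)
    \<and> is_hilbert_sum M (closed_span M (SJ G J))
          (\<lambda>n. case n of 0 \<Rightarrow> V0 G M | Suc j \<Rightarrow> W G M J c j)"
proof -
  have wavelets: "pf_wavelets G xv M J c"
    using assms by (simp add: pf_wavelets_def pf_wavelets_axioms_def pf_k_graph_def pf_k_graph_axioms_def)
  note orthonormal = pf_wavelets.wavelets_orthonormal[OF wavelets]
    and levels = pf_wavelets.wavelet_levels_orthogonal[OF wavelets]
    and dense = pf_k_graph.L2_eq_closed_span_SJ[OF pf_wavelets.axioms(1)[OF wavelets] assms(7)]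
    and hilbert = pf_wavelets.hilbert_sum_level_basis[OF wavelets]
  note wavelet_simps = pf_wavelets.wavelet_index_def[OF wavelets] pf_wavelets.wavelet_def[OF wavelets]
  show ?thesis
  proof (intro conjI allI ballI impI)
    fix j :: nat
    show "orthonormal_family M
        {(v, l, m). v \<in> verts G \<and> l \<in> Cset G J j v \<and> m \<in> {1..card (Dset G J v) - 1}}
        (\<lambda>(v, l, m). Sop G l (wavelet_f G J c m v))"
      using orthonormal[of j] by (simp only: wavelet_simps)
  next
    fix i j v v' l \<mu> m m'
    assume "v \<in> verts G" "v' \<in> verts G" "l \<in> Cset G J j v" "\<mu> \<in> Cset G J i v'"
      "m \<in> {1..card (Dset G J v) - 1}" "m' \<in> {1..card (Dset G J v') - 1}" "0 < i \<and> i < j"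
    then show "(LINT x|M. Sop G l (wavelet_f G J c m v) x * cnj (Sop G \<mu> (wavelet_f G J c m' v') x)) = 0"
      using levels[of i j "(v, l, m)" "(v', \<mu>, m')"] by (simp add: wavelet_simps L2_inner_def)
  next
    show "L2 M = closed_span M (SJ G J)" by (rule dense)
    show "is_hilbert_sum M (closed_span M (SJ G J))
        (\<lambda>n. case n of 0 \<Rightarrow> V0 G M | Suc j \<Rightarrow> W G M J c j)"
      using hilbert
      by (simp only: pf_wavelets.closed_span_SJ_eq_level_basis[OF wavelets] pf_wavelets.closed_span_level_basis[OF wavelets])
  qed
qed

end
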